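(* Fix any $p\in\mathbb N$ with $p\ge2$ and any $\alpha\in(0,1)$. Then there exist some $\kappa=\kappa(p,\alpha)>0$ and a set $E\subseteq[0,1]$ with $\dim_{\mathbb F}(E)\ge\alpha$ such that $E$ contains no nontrivial solution of $$tx+(1-t)y=z\quad\text{for all } t\in\bigcup_{q=1}^{p-1}\Bigl(\frac qp-\kappa,\frac qp+\kappa\Bigr);$$ that is, for no $t$ in this union do there exist pairwise distinct $x,y,z\in E$ with $tx+(1-t)y=z$.
   Context: $\mathbb N=\{1,2,\ldots\}$. A solution $(x,y,z)$ of the equation is nontrivial if its entries are all distinct. The Fourier transform of a measure $\mu$ is $\widehat\mu(\xi)=\int e^{-ix\xi}\,d\mu(x)$. The Fourier dimension $\dim_{\mathbb F}(A)$ of a Borel set $A\subseteq\mathbb R$ is the supremum of exponents $\beta\le 1$ for which there exist a probability measure $\mu$ supported on $A$ and a finite constant $C_2>0$ with $|\widehat\mu(\xi)|\le C_2(1+|\xi|)^{-\beta/2}$ for all $\xi\in\mathbb R$. *)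

theory Defs
  imports "HOL-Probability.Probability"
begin

text \<open>The sign convention differs from the library's characteristic function:
  \<open>fourier_transform \<mu> \<xi> = char \<mu> (- \<xi>)\<close>.\<close>

definition fourier_transform :: "real measure \<Rightarrow> real \<Rightarrow> complex" where
  "fourier_transform \<mu> \<xi> = (CLINT x|\<mu>. exp (- (\<i> * complex_of_real (x * \<xi>))))"

text \<open>The locale predicate \<open>real_distribution \<mu>\<close> says that \<open>\<mu>\<close> is a Borel probability measure on
  the real line. A measure is supported on a Borel set \<open>A\<close> if it gives \<open>A\<close> full mass, so
  \<open>A\<close> need not contain the closed topological support. The supremum is taken in the extended
  reals, so that the empty set, which carries no probability measure, has dimension
  \<open>- \<infinity>\<close> instead of an unspecified real. For non-empty Borel sets the value lies in
  \<open>[0, 1]\<close>. Only Borel sets \<open>A\<close> are meaningful arguments.\<close>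

definition fourier_dimension :: "real set \<Rightarrow> ereal" where
  "fourier_dimension A =
     Sup {ereal \<beta> | \<beta>. \<beta> \<le> 1 \<and>
       (\<exists>\<mu> C. real_distribution \<mu> \<and> measure \<mu> A = 1 \<and> 0 < C \<and>
         (\<forall>\<xi>. cmod (fourier_transform \<mu> \<xi>) \<le> C * (1 + \<bar>\<xi>\<bar>) powr (- \<beta> / 2)))}"

end

theory Submission
  imports Defs
begin

text \<open>Behrend's sphere construction gives a set \<open>A\<close> of more than \<open>N\<^sup>\<alpha>\<close> residues modulo \<open>N\<close> without
  approximate solutions of \<open>q a + (p - q) b = p c\<close>, a property that survives cyclic shifts.
  Divide \<open>[0, 1]\<close> into \<open>N\<close> cells, keep those indexed by a shift of \<open>A\<close>, and iterate, choosing the shift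
  separately in each surviving cell. If \<open>\<kappa> = 1 / (p N)\<close> and \<open>x, y, z\<close> is a solution for a parameter within
  \<open>\<kappa>\<close> of \<open>q / p\<close>, then at each stage at which the three points share a cell their subcells form an
  approximate solution in a shift of \<open>A\<close>, so they share the subcell as well; hence \<open>x = y\<close>.

  Averaged over the shifts, stage \<open>k + 1\<close> has the same Fourier transform as stage \<open>k\<close>, so by Hoeffding's
  inequality the shifts can be chosen with a square root cancellation. The difference of the two
  transforms is the transform of an interval of length \<open>N\<^bsup>-(k+1)\<^esup>\<close> times a trigonometric sum that is
  periodic, so finitely many frequencies suffice for the union bound. Since
  \<open>card A > N\<^sup>\<alpha>\<close>, the differences add up to \<open>O(\<bar>\<xi>\<bar>\<^bsup>-\<alpha>/2\<^esup>)\<close>, which a weak limit of the stages inherits.\<close>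

subsection \<open>Large sets without solutions\<close>

text \<open>Reduction modulo \<open>B\<close> isolates the lowest digit, and the induction strips it
  off. Equations between numbers become equations between coordinate vectors in this way.\<close>

lemma digits_unique:
  fixes x y :: "nat \<Rightarrow> nat"
  assumes "(\<Sum>i<n. x i * B ^ i) = (\<Sum>i<n. y i * B ^ i)"
    and "\<And>i. i < n \<Longrightarrow> x i < B" "\<And>i. i < n \<Longrightarrow> y i < B" and "i < n"
  shows "x i = y i"
  using assms
proof (induction n arbitrary: x y i)
  case (Suc n)
  have split: "(\<Sum>i<Suc n. w i * B ^ i) = w 0 + B * (\<Sum>i<n. w (Suc i) * B ^ i)" for w :: "nat \<Rightarrow> nat"
    by (subst sum.lessThan_Suc_shift) (simp add: sum_distrib_left mult_ac)
  have eq: "x 0 + B * (\<Sum>i<n. x (Suc i) * B ^ i) = y 0 + B * (\<Sum>i<n. y (Suc i) * B ^ i)"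
    using Suc.prems(1) by (simp only: split)
  have lt: "x 0 < B" "y 0 < B"
    using Suc.prems(2,3) by auto
  have "(x 0 + B * (\<Sum>i<n. x (Suc i) * B ^ i)) mod B = (y 0 + B * (\<Sum>i<n. y (Suc i) * B ^ i)) mod B"
    by (simp only: eq)
  then have 0: "x 0 = y 0"
    using lt by simp
  then have "(\<Sum>i<n. x (Suc i) * B ^ i) = (\<Sum>i<n. y (Suc i) * B ^ i)"
    using eq lt by simp
  then have "x (Suc j) = y (Suc j)" if "j < n" for j
    by (rule Suc.IH) (use Suc.prems(2,3) that in auto)
  with 0 Suc.prems(4) show ?case
    by (cases i) auto
qed simp

lemma digits_less:
  fixes x :: "nat \<Rightarrow> nat"
  assumes "\<And>i. i < n \<Longrightarrow> x i < B"
  shows "(\<Sum>i<n. x i * B ^ i) < B ^ n"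
  using assms
proof (induction n)
  case (Suc n)
  have "(\<Sum>i<Suc n. x i * B ^ i) < B ^ n + x n * B ^ n"
    using Suc by simp
  also have "\<dots> = (x n + 1) * B ^ n"
    by simp
  also have "\<dots> \<le> B * B ^ n"
    using Suc.prems[of n] by (intro mult_right_mono) auto
  finally show ?case by simp
qed simp

text \<open>A sphere is strictly convex, so it contains no point of a nondegenerate segment between two of
  its points.\<close>

lemma sphere_convex_combination:
  fixes x y z :: "nat \<Rightarrow> nat"
  assumes q: "0 < q" "q < p"
    and comb: "\<And>i. i < n \<Longrightarrow> q * x i + (p - q) * y i = p * z i"
    and sphere: "(\<Sum>i<n. (x i)\<^sup>2) = r" "(\<Sum>i<n. (y i)\<^sup>2) = r" "(\<Sum>i<n. (z i)\<^sup>2) = r"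
    and i: "i < n"
  shows "x i = y i \<and> y i = z i"
proof -
  define P Q :: real where "P = real p" and "Q = real q"
  have Q: "0 < Q" "Q < P"
    using q by (auto simp: P_def Q_def)
  have comb': "Q * real (x i) + (P - Q) * real (y i) = P * real (z i)" if "i < n" for i
    using arg_cong[OF comb[OF that], of real] q by (simp add: P_def Q_def of_nat_diff)
  \<comment> \<open>The variance identity for two weighted points. Summed over the coordinates the
    left side vanishes, because the three squared norms agree, while each term on the right is
    nonnegative.\<close>
  have sq: "P * (Q * (real (x i))\<^sup>2 + (P - Q) * (real (y i))\<^sup>2 - P * (real (z i))\<^sup>2)
      = Q * (P - Q) * (real (x i) - real (y i))\<^sup>2" if "i < n" for i
  proof -
    have "P * (P * (real (z i))\<^sup>2) = (Q * real (x i) + (P - Q) * real (y i))\<^sup>2"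
      unfolding comb'[OF that] by (simp add: power2_eq_square)
    then show ?thesis
      by (simp add: power2_eq_square algebra_simps)
  qed
  have sphere': "(\<Sum>i<n. (real (x i))\<^sup>2) = real r" "(\<Sum>i<n. (real (y i))\<^sup>2) = real r"
      "(\<Sum>i<n. (real (z i))\<^sup>2) = real r"
    using sphere[THEN arg_cong, of real] by simp_all
  have "(\<Sum>i<n. Q * (P - Q) * (real (x i) - real (y i))\<^sup>2)
      = (\<Sum>i<n. P * (Q * (real (x i))\<^sup>2 + (P - Q) * (real (y i))\<^sup>2 - P * (real (z i))\<^sup>2))"
    using sq by simp
  also have "\<dots> = P * (Q * (\<Sum>i<n. (real (x i))\<^sup>2) + (P - Q) * (\<Sum>i<n. (real (y i))\<^sup>2)
      - P * (\<Sum>i<n. (real (z i))\<^sup>2))"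
    by (simp add: sum_subtractf sum.distrib sum_distrib_left distrib_left right_diff_distrib)
  also have "\<dots> = 0"
    unfolding sphere' by (simp add: algebra_simps)
  finally have "(\<Sum>i<n. Q * (P - Q) * (real (x i) - real (y i))\<^sup>2) = 0" .
  then have "Q * (P - Q) * (real (x i) - real (y i))\<^sup>2 = 0"
    using Q i by (subst (asm) sum_nonneg_eq_0_iff) auto
  then have xy: "x i = y i"
    using Q by simp
  then have "P * real (y i) = P * real (z i)"
    using comb'[OF i] by (simp add: algebra_simps)
  with xy Q show ?thesis by simp
qed

text \<open>The vectors in \<open>{..<d}\<close> to the power \<open>n\<close> have at most
  \<open>n * d^2 + 1\<close> squared norms, so by pigeonhole one sphere is large. Reading its
  vectors as numbers in base \<open>p * d\<close> rather than \<open>d\<close> makes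
  \<open>q * x + (p - q) * y\<close> and \<open>p * z\<close> carry-free, so a solution among the
  numbers is a solution in every coordinate and strict convexity applies.\<close>

lemma behrend_sphere:
  assumes p: "p \<ge> 2" and "d > 0"
  shows "\<exists>A. A \<subseteq> {..<(p * d) ^ n} \<and> real d ^ n \<le> real (card A) * (real n * real d ^ 2 + 1) \<and>
    (\<forall>q a b c. 0 < q \<longrightarrow> q < p \<longrightarrow> a \<in> A \<longrightarrow> b \<in> A \<longrightarrow> c \<in> A \<longrightarrow>
       q * a + (p - q) * b = p * c \<longrightarrow> a = b \<and> b = c)"
proof -
  define X where "X = PiE {..<n} (\<lambda>_. {..<d})"
  define norm2 where "norm2 x = (\<Sum>i<n. (x i)\<^sup>2)" for x :: "nat \<Rightarrow> nat"
  define num where "num x = (\<Sum>i<n. x i * (p * d) ^ i)" for x :: "nat \<Rightarrow> nat"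
  have finX: "finite X" and cardX: "card X = d ^ n"
    unfolding X_def by (auto intro: finite_PiE simp: card_PiE)
  have ltd: "x i < d" if "x \<in> X" "i < n" for x i
    using that unfolding X_def by auto
  have dpd: "d \<le> p * d"
    using p by simp
  have "norm2 \<in> X \<rightarrow> {..n * d\<^sup>2}"
  proof
    fix x assume "x \<in> X"
    then have "norm2 x \<le> (\<Sum>i<n. d\<^sup>2)"
      unfolding norm2_def by (intro sum_mono power_mono) (auto dest: ltd less_imp_le)
    then show "norm2 x \<in> {..n * d\<^sup>2}" by simp
  qed
  have "\<exists>r. d ^ n \<le> card {x \<in> X. norm2 x = r} * (n * d\<^sup>2 + 1)"
  proof (rule ccontr)
    assume "\<not> ?thesis"
    then have less: "card {x \<in> X. norm2 x = r} * (n * d\<^sup>2 + 1) < d ^ n" for r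
      by (simp add: not_le)
    have "X = (\<Union>r\<in>{..n * d\<^sup>2}. {x \<in> X. norm2 x = r})"
      using \<open>norm2 \<in> X \<rightarrow> {..n * d\<^sup>2}\<close> by auto
    then have "card X \<le> (\<Sum>r\<in>{..n * d\<^sup>2}. card {x \<in> X. norm2 x = r})"
      using card_UN_le[of "{..n * d\<^sup>2}" "\<lambda>r. {x \<in> X. norm2 x = r}"] by simp
    then have "d ^ n * (n * d\<^sup>2 + 1) \<le> (\<Sum>r\<in>{..n * d\<^sup>2}. card {x \<in> X. norm2 x = r} * (n * d\<^sup>2 + 1))"
      unfolding cardX sum_distrib_right[symmetric] by (rule mult_right_mono) simp
    also have "\<dots> < (\<Sum>r\<in>{..n * d\<^sup>2}. d ^ n)"
      by (rule sum_strict_mono) (use less in auto)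
    finally show False by simp
  qed
  then obtain r where r: "d ^ n \<le> card {x \<in> X. norm2 x = r} * (n * d\<^sup>2 + 1)" by blast
  define Y where "Y = {x \<in> X. norm2 x = r}"
  have inj: "inj_on num Y"
  proof (rule inj_onI)
    fix x y assume xy: "x \<in> Y" "y \<in> Y" "num x = num y"
    then have X: "x \<in> X" "y \<in> X" by (auto simp: Y_def)
    have "x i = y i" if "i < n" for i
      by (rule digits_unique[OF xy(3)[unfolded num_def] _ _ that])
        (use X ltd dpd in \<open>force intro: less_le_trans\<close>)+
    with X show "x = y"
      unfolding X_def by (intro PiE_ext) auto
  qed
  have "num x < (p * d) ^ n" if "x \<in> X" for x
    unfolding num_def by (rule digits_less) (rule less_le_trans[OF ltd[OF that] dpd])
  then have "num ` Y \<subseteq> {..<(p * d) ^ n}"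
    by (auto simp: Y_def)
  moreover have "real d ^ n \<le> real (card (num ` Y)) * (real n * real d ^ 2 + 1)"
  proof -
    have "real (d ^ n) \<le> real (card Y * (n * d\<^sup>2 + 1))"
      using r unfolding Y_def of_nat_le_iff .
    then show ?thesis
      by (simp add: card_image[OF inj] algebra_simps)
  qed
  moreover have "num x = num y \<and> num y = num z"
    if q: "0 < q" "q < p" and Y: "x \<in> Y" "y \<in> Y" "z \<in> Y"
      and eq: "q * num x + (p - q) * num y = p * num z" for q x y z
  proof -
    have X: "x \<in> X" "y \<in> X" "z \<in> X" using Y by (auto simp: Y_def)
    have "(\<Sum>i<n. (q * x i + (p - q) * y i) * (p * d) ^ i) = (\<Sum>i<n. (p * z i) * (p * d) ^ i)"
      using eq by (simp only: num_def sum_distrib_left sum.distrib distrib_right mult.assoc)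
    moreover have "q * x i + (p - q) * y i < p * d" "p * z i < p * d" if "i < n" for i
    proof -
      have "q * x i + (p - q) * y i < q * d + (p - q) * d"
        using q ltd[OF X(1) that] ltd[OF X(2) that] by (intro add_strict_mono) auto
      also have "\<dots> = p * d"
        using q by (simp flip: distrib_right)
      finally show "q * x i + (p - q) * y i < p * d" .
      show "p * z i < p * d"
        using q ltd[OF X(3) that] by simp
    qed
    ultimately have "q * x i + (p - q) * y i = p * z i" if "i < n" for i
      using that by (rule digits_unique)
    then have "x i = y i \<and> y i = z i" if "i < n" for i
      using sphere_convex_combination[OF q, of n x y z r i] Y that by (simp add: Y_def norm2_def)
    then show ?thesis
      by (simp add: num_def)
  qed
  ultimately show ?thesis
    by (intro exI[of _ "num ` Y"]) blast
qed

text \<open>The slack \<open>p + 1\<close> absorbs the positions of the points inside their cells and the error in \<open>t\<close>; working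
  modulo \<open>N\<close> makes the property invariant under cyclic shifts.\<close>

definition avoiding :: "nat \<Rightarrow> nat \<Rightarrow> nat set \<Rightarrow> bool" where
  "avoiding p N A \<longleftrightarrow> A \<subseteq> {..<N} \<and> (\<forall>q a b c. \<forall>m::int. 0 < q \<longrightarrow> q < p \<longrightarrow>
     a \<in> A \<longrightarrow> b \<in> A \<longrightarrow> c \<in> A \<longrightarrow>
     \<bar>int q * int a + (int p - int q) * int b - int p * int c - m * int N\<bar> \<le> int p + 1 \<longrightarrow>
     a = b \<and> b = c)"

text \<open>Scaling by \<open>p + 2\<close> makes every approximate solution exact, and keeping the set in an
  interval of length \<open>N / p\<close> rules out any wrap-around modulo \<open>N\<close>.\<close>

lemma avoiding_dilate:
  fixes A :: "nat set"
  assumes p: "p \<ge> 2" and A: "A \<subseteq> {..<M}"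
    and sol: "\<And>q a b c. 0 < q \<Longrightarrow> q < p \<Longrightarrow> a \<in> A \<Longrightarrow> b \<in> A \<Longrightarrow> c \<in> A \<Longrightarrow>
       q * a + (p - q) * b = p * c \<Longrightarrow> a = b \<and> b = c"
  shows "avoiding p (p * (p + 2) * M) ((*) (p + 2) ` A)"
  unfolding avoiding_def
proof (intro conjI allI impI)
  define L where "L = p + 2"
  have "L * a < p * L * M" if "a \<in> A" for a
  proof -
    have "L * a < L * M" using A that by (intro mult_strict_left_mono) (auto simp: L_def)
    also have "\<dots> \<le> p * (L * M)" using p by simp
    finally show ?thesis by simp
  qed
  then show "(*) (p + 2) ` A \<subseteq> {..<p * (p + 2) * M}"
    by (auto simp: L_def)
  fix q a' b' c' and m :: int
  assume q: "0 < q" "q < p" and mem: "a' \<in> (*) (p + 2) ` A" "b' \<in> (*) (p + 2) ` A" "c' \<in> (*) (p + 2) ` A"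
    and small: "\<bar>int q * int a' + (int p - int q) * int b' - int p * int c' - m * int (p * (p + 2) * M)\<bar> \<le> int p + 1"
  obtain a b c where abc: "a \<in> A" "b \<in> A" "c \<in> A" "a' = (p + 2) * a" "b' = (p + 2) * b" "c' = (p + 2) * c"
    using mem by blast
  define e where "e = int q * int a + (int p - int q) * int b - int p * int c"
  have "\<bar>(int p + 2) * (e - m * (int p * int M))\<bar> \<le> int p + 1"
    using small unfolding abc e_def by (simp add: algebra_simps)
  moreover have "\<bar>(int p + 2) * (e - m * (int p * int M))\<bar> = (int p + 2) * \<bar>e - m * (int p * int M)\<bar>"
    by (simp add: abs_mult)
  ultimately have "(int p + 2) * \<bar>e - m * (int p * int M)\<bar> \<le> int p + 1"
    by (simp only:)
  also have "\<dots> < (int p + 2) * 1" by simp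
  finally have "(int p + 2) * \<bar>e - m * (int p * int M)\<bar> < (int p + 2) * 1" .
  then have "\<bar>e - m * (int p * int M)\<bar> < 1"
    by (subst (asm) mult_less_cancel_left_pos) auto
  then have e: "e = m * (int p * int M)" by simp
  have lt: "int a < int M" "int b < int M" "int c < int M"
    using A abc by auto
  have "int q * int a + (int p - int q) * int b < int q * int M + (int p - int q) * int M"
    using q lt by (intro add_strict_mono mult_strict_left_mono) auto
  then have "e < int p * int M"
    unfolding e_def using q by (simp add: algebra_simps)
      (smt (verit) mult_nonneg_nonneg of_nat_0_le_iff)
  moreover have "- (int p * int M) < e"
  proof -
    have "int p * int c < int p * int M" using q lt by simp
    moreover have "0 \<le> int q * int a + (int p - int q) * int b" using q by simp
    ultimately show ?thesis unfolding e_def by linarith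
  qed
  ultimately have "\<bar>m * (int p * int M)\<bar> < 1 * (int p * int M)"
    unfolding e by simp
  moreover have "\<bar>m * (int p * int M)\<bar> = \<bar>m\<bar> * (int p * int M)"
    by (simp add: abs_mult)
  ultimately have "\<bar>m\<bar> * (int p * int M) < 1 * (int p * int M)"
    by (simp only:)
  then have "\<bar>m\<bar> < 1"
    by (rule mult_right_less_imp_less) simp
  with e have "e = 0" by simp
  then have "int (q * a + (p - q) * b) = int (p * c)"
    unfolding e_def using q by (simp add: of_nat_diff)
  then have "a = b \<and> b = c"
    using sol[OF q abc(1-3)] by linarith
  then show "a' = b'" "b' = c'"
    using abc by auto
qed

text \<open>First \<open>d\<close> is taken so large that \<open>p * d\<close> to the power \<alpha>
  is below \<open>d\<close>. Then \<open>d ^ n\<close> exceeds the corresponding power of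
  \<open>(p * d) ^ n\<close> by the exponential factor \<open>(1 / \<rho>) ^ n\<close>, and a large
  \<open>n\<close> absorbs both the pigeonhole loss \<open>n * d^2 + 1\<close> and the loss
  \<open>L powr \<alpha>\<close> from the dilation.\<close>

lemma ex_large_avoiding:
  fixes \<alpha> :: real
  assumes p: "p \<ge> 2" and \<alpha>: "0 < \<alpha>" "\<alpha> < 1"
  shows "\<exists>N A. N > 0 \<and> avoiding p N A \<and> real N powr \<alpha> < real (card A)"
proof -
  define L where "L = p * (p + 2)"
  \<comment> \<open>This is \<open>p powr \<alpha> < d powr (1 - \<alpha>)\<close> solved for
    \<open>d\<close>.\<close>
  obtain d where d0: "(real p powr \<alpha>) powr (1 / (1 - \<alpha>)) < real d"
    using reals_Archimedean2 by blast
  then have "d > 0"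
    using p by (intro Nat.gr0I) (auto simp: not_less[symmetric])
  have "real p powr \<alpha> = ((real p powr \<alpha>) powr (1 / (1 - \<alpha>))) powr (1 - \<alpha>)"
    using \<alpha> p by (simp add: powr_powr)
  also have "\<dots> < real d powr (1 - \<alpha>)"
    using d0 \<alpha> by (intro powr_less_mono2) auto
  finally have "real p powr \<alpha> < real d powr (1 - \<alpha>)" .
  then have d: "real (p * d) powr \<alpha> < real d"
    using \<open>d > 0\<close> by (simp add: powr_mult powr_diff field_simps)
  define \<rho> where "\<rho> = real (p * d) powr \<alpha> / real d"
  have \<rho>: "0 < \<rho>" "\<rho> < 1"
    using d p \<open>d > 0\<close> by (auto simp: \<rho>_def)
  have "(\<lambda>n. real L powr \<alpha> * (real d ^ 2 * (real n * \<rho> ^ n) + \<rho> ^ n)) \<longlonglongrightarrow> real L powr \<alpha> * (real d ^ 2 * 0 + 0)"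
    using \<rho> by (intro tendsto_intros powser_times_n_limit_0 LIMSEQ_power_zero) auto
  then have "eventually (\<lambda>n. real L powr \<alpha> * (real d ^ 2 * (real n * \<rho> ^ n) + \<rho> ^ n) < 1) sequentially"
    by (rule order_tendstoD) simp
  then obtain n where n: "real L powr \<alpha> * (real d ^ 2 * (real n * \<rho> ^ n) + \<rho> ^ n) < 1"
    by (auto dest: eventually_happens)
  obtain A where A: "A \<subseteq> {..<(p * d) ^ n}"
    "real d ^ n \<le> real (card A) * (real n * real d ^ 2 + 1)"
    "\<And>q a b c. 0 < q \<Longrightarrow> q < p \<Longrightarrow> a \<in> A \<Longrightarrow> b \<in> A \<Longrightarrow> c \<in> A \<Longrightarrow>
       q * a + (p - q) * b = p * c \<Longrightarrow> a = b \<and> b = c"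
    using behrend_sphere[OF p \<open>d > 0\<close>, of n] by metis
  define N where "N = p * (p + 2) * (p * d) ^ n"
  have "real N powr \<alpha> = real L powr \<alpha> * (real (p * d) powr \<alpha>) ^ n"
    unfolding N_def L_def[symmetric] using p \<open>d > 0\<close> by (simp add: powr_mult powr_power powr_realpow[symmetric] powr_powr mult_ac)
  also have "\<dots> = real L powr \<alpha> * \<rho> ^ n * real d ^ n"
    using \<open>d > 0\<close> by (simp add: \<rho>_def power_divide)
  also have "\<dots> \<le> real L powr \<alpha> * \<rho> ^ n * (real (card A) * (real n * real d ^ 2 + 1))"
    using A(2) \<rho> by (intro mult_left_mono) auto
  also have "\<dots> = real L powr \<alpha> * (real d ^ 2 * (real n * \<rho> ^ n) + \<rho> ^ n) * real (card A)"
    by (simp add: algebra_simps)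
  also have "\<dots> < 1 * real (card A)"
  proof (rule mult_strict_right_mono[OF n])
    have "0 < real d ^ n" using \<open>d > 0\<close> by simp
    then show "0 < real (card A)" using A(2)
      by (intro of_nat_0_less_iff[THEN iffD2] Nat.gr0I) (simp only: of_nat_0 mult_zero_left)
  qed
  finally have "real N powr \<alpha> < real (card ((*) (p + 2) ` A))"
    by (subst card_image) (auto intro!: inj_onI simp only: mult_cancel1)
  moreover have "avoiding p N ((*) (p + 2) ` A)"
    unfolding N_def using avoiding_dilate[OF p A(1) A(3)] .
  moreover have "N > 0"
    using p \<open>d > 0\<close> by (simp add: N_def)
  ultimately show ?thesis by blast
qed

subsection \<open>Simultaneous Hoeffding bounds\<close>

lemma exp_le_quadratic:
  fixes x :: real
  assumes "\<bar>x\<bar> \<le> 1"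
  shows "exp x \<le> 1 + x + x\<^sup>2"
proof (cases "x \<ge> 0")
  case True
  then show ?thesis using assms by (intro exp_bound) auto
next
  case False
  \<comment> \<open>The product is \<open>1 - x^3\<close>.\<close>
  have "1 \<le> (1 - x) * (1 + x + x\<^sup>2)"
    using False by (simp add: algebra_simps power2_eq_square mult_nonneg_nonpos2 zero_le_mult_iff mult_le_0_iff)
  also have "\<dots> \<le> exp (- x) * (1 + x + x\<^sup>2)"
  proof (rule mult_right_mono)
    show "1 - x \<le> exp (- x)" using exp_ge_add_one_self[of "- x"] by simp
    show "0 \<le> 1 + x + x\<^sup>2" using assms zero_le_power2[of x] by linarith
  qed
  finally show ?thesis
    by (simp add: exp_minus field_simps)
qed

text \<open>Independent uniform choices are averages over all functions \<open>s\<close>: some \<open>s\<close> does not exceed the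
  average of the sum of the exponential moments.\<close>

lemma simultaneous_hoeffding:
  fixes X :: "'t \<Rightarrow> 'j \<Rightarrow> nat \<Rightarrow> real"
  assumes J: "finite J" "J \<noteq> {}" and T: "finite T" "T \<noteq> {}" and N: "N > 0"
    and bnd: "\<And>t j v. t \<in> T \<Longrightarrow> j \<in> J \<Longrightarrow> v < N \<Longrightarrow> \<bar>X t j v\<bar> \<le> 2"
    and mean: "\<And>t j. t \<in> T \<Longrightarrow> j \<in> J \<Longrightarrow> (\<Sum>v<N. X t j v) = 0"
  shows "\<exists>s. \<forall>t\<in>T. (\<Sum>j\<in>J. X t j (s j)) \<le> 2 * sqrt (card J) * (ln (card T) + 1)"
proof -
  \<comment> \<open>With this value \<open>4 * \<eta>^2 * card J = 1\<close>, so the moment bound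
    for a whole sum is just \<open>exp 1\<close>; moreover \<eta> is at most 1/2, which keeps the
    exponents in the range of \<open>exp_le_quadratic\<close>.\<close>
  define \<eta> :: real where "\<eta> = 1 / (2 * sqrt (card J))"
  have cJ: "card J \<ge> 1" using J by (simp add: Suc_leI card_gt_0_iff)
  have \<eta>: "0 < \<eta>" "\<eta> \<le> 1 / 2"
    using cJ by (auto simp: \<eta>_def field_simps)
  define S where "S = PiE J (\<lambda>_. {..<N})"
  have finS: "finite S" and cardS: "card S = N ^ card J"
    using J by (auto simp: S_def finite_PiE card_PiE)
  have "0 < card S" using N cardS by simp
  then have neS: "S \<noteq> {}" by auto
  have mgf: "(\<Sum>v<N. exp (\<eta> * X t j v)) \<le> real N * exp (4 * \<eta>\<^sup>2)" if "t \<in> T" "j \<in> J" for t j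
  proof -
    have "(\<Sum>v<N. exp (\<eta> * X t j v)) \<le> (\<Sum>v<N. 1 + \<eta> * X t j v + 4 * \<eta>\<^sup>2)"
    proof (rule sum_mono)
      fix v assume "v \<in> {..<N}"
      then have b: "\<bar>X t j v\<bar> \<le> 2" using bnd that by auto
      then have "\<eta> * \<bar>X t j v\<bar> \<le> 1 / 2 * 2" using \<eta> by (intro mult_mono) auto
      then have "exp (\<eta> * X t j v) \<le> 1 + \<eta> * X t j v + (\<eta> * X t j v)\<^sup>2"
        using \<eta> by (intro exp_le_quadratic) (simp add: abs_mult)
      also have "(\<eta> * X t j v)\<^sup>2 \<le> 4 * \<eta>\<^sup>2"
        using mult_left_mono[OF power_mono[OF b, of 2], of "\<eta>\<^sup>2"] by (simp add: power_mult_distrib)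
      finally show "exp (\<eta> * X t j v) \<le> 1 + \<eta> * X t j v + 4 * \<eta>\<^sup>2" by simp
    qed
    also have "\<dots> = real N * (1 + 4 * \<eta>\<^sup>2)"
      using mean[OF that] by (simp add: sum.distrib sum_distrib_left[symmetric] algebra_simps)
    also have "\<dots> \<le> real N * exp (4 * \<eta>\<^sup>2)"
      using exp_ge_add_one_self[of "4 * \<eta>\<^sup>2"] by (intro mult_left_mono) auto
    finally show ?thesis .
  qed
  have "(\<Sum>s\<in>S. \<Sum>t\<in>T. exp (\<eta> * (\<Sum>j\<in>J. X t j (s j)))) = (\<Sum>t\<in>T. \<Sum>s\<in>S. \<Prod>j\<in>J. exp (\<eta> * X t j (s j)))"
    by (subst sum.swap) (simp add: sum_distrib_left exp_sum J)
  \<comment> \<open>Independence: a sum over all choice functions of a product over \<open>J\<close>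
    factors.\<close>
  also have "\<dots> = (\<Sum>t\<in>T. \<Prod>j\<in>J. \<Sum>v<N. exp (\<eta> * X t j v))"
    unfolding S_def using J by (subst prod_sum_PiE) auto
  also have "\<dots> \<le> (\<Sum>t\<in>T. \<Prod>j\<in>J. real N * exp (4 * \<eta>\<^sup>2))"
    using mgf by (intro sum_mono prod_mono) (auto intro: sum_nonneg)
  also have "\<dots> = (\<Sum>s\<in>S. real (card T) * exp (4 * \<eta>\<^sup>2) ^ card J)"
    by (simp add: cardS power_mult_distrib)
  finally have "(\<Sum>s\<in>S. \<Sum>t\<in>T. exp (\<eta> * (\<Sum>j\<in>J. X t j (s j)))) \<le> (\<Sum>s\<in>S. real (card T) * exp (4 * \<eta>\<^sup>2) ^ card J)" .
  then obtain s where s: "(\<Sum>t\<in>T. exp (\<eta> * (\<Sum>j\<in>J. X t j (s j)))) \<le> real (card T) * exp (4 * \<eta>\<^sup>2) ^ card J"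
    using sum_strict_mono[OF finS neS] by (meson not_le)
  have e1: "4 * \<eta>\<^sup>2 * real (card J) = 1"
    using cJ by (simp add: \<eta>_def power_divide power_mult_distrib)
  have "(\<Sum>j\<in>J. X t j (s j)) \<le> 2 * sqrt (card J) * (ln (card T) + 1)" if "t \<in> T" for t
  proof -
    have "exp (\<eta> * (\<Sum>j\<in>J. X t j (s j))) \<le> (\<Sum>t\<in>T. exp (\<eta> * (\<Sum>j\<in>J. X t j (s j))))"
      using that T by (intro member_le_sum) auto
    also note s
    also have "exp (4 * \<eta>\<^sup>2) ^ card J = exp 1"
      using e1 by (simp add: exp_of_nat2_mult[symmetric])
    also have "real (card T) * exp 1 = exp (ln (card T) + 1)"
      using T by (simp add: exp_add card_gt_0_iff)
    finally have "\<eta> * (\<Sum>j\<in>J. X t j (s j)) \<le> ln (card T) + 1" by simp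
    then show ?thesis
      using cJ by (simp add: \<eta>_def field_simps)
  qed
  then show ?thesis by blast
qed

text \<open>The real parts in the four directions of \<open>D\<close> bound the real and imaginary
  parts with both signs. Testing them multiplies the number of test points by 4, and adding the two
  parts doubles the constant.\<close>

lemma simultaneous_hoeffding_complex:
  fixes Y :: "'t \<Rightarrow> 'j \<Rightarrow> nat \<Rightarrow> complex"
  assumes J: "finite J" "J \<noteq> {}" and T: "finite T" "T \<noteq> {}" and N: "N > 0"
    and bnd: "\<And>t j v. t \<in> T \<Longrightarrow> j \<in> J \<Longrightarrow> v < N \<Longrightarrow> cmod (Y t j v) \<le> 2"
    and mean: "\<And>t j. t \<in> T \<Longrightarrow> j \<in> J \<Longrightarrow> (\<Sum>v<N. Y t j v) = 0"
  shows "\<exists>s. \<forall>t\<in>T. cmod (\<Sum>j\<in>J. Y t j (s j)) \<le> 4 * sqrt (card J) * (ln (4 * card T) + 1)"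
proof -
  define D where "D = {1, -1, \<i>, -\<i>}"
  have D: "finite D" "D \<noteq> {}" "card D = 4"
    by (auto simp: D_def card_insert_if complex_eq_iff)
  define X where "X = (\<lambda>(t, c) j v. Re (c * Y t j v))"
  have "\<exists>s. \<forall>u\<in>T \<times> D. (\<Sum>j\<in>J. X u j (s j)) \<le> 2 * sqrt (card J) * (ln (card (T \<times> D)) + 1)"
  proof (rule simultaneous_hoeffding[OF J _ _ N])
    fix u j v assume "u \<in> T \<times> D" "j \<in> J" "v < N"
    then obtain t c where u: "u = (t, c)" "t \<in> T" "c \<in> D" by auto
    have "cmod c = 1" using u by (auto simp: D_def)
    have "\<bar>X u j v\<bar> \<le> cmod (c * Y t j v)"
      unfolding u X_def by (simp only: prod.case abs_Re_le_cmod)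
    also have "\<dots> \<le> 2"
      using bnd[OF \<open>t \<in> T\<close> \<open>j \<in> J\<close> \<open>v < N\<close>] \<open>cmod c = 1\<close> by (simp add: norm_mult)
    finally show "\<bar>X u j v\<bar> \<le> 2" .
  next
    fix u j assume "u \<in> T \<times> D" "j \<in> J"
    then obtain t c where u: "u = (t, c)" "t \<in> T" by auto
    have "(\<Sum>v<N. X u j v) = Re (c * (\<Sum>v<N. Y t j v))"
      by (simp only: u X_def prod.case Re_sum sum_distrib_left)
    then show "(\<Sum>v<N. X u j v) = 0"
      using mean[OF u(2) \<open>j \<in> J\<close>] by simp
  qed (use T D in auto)
  then obtain s where s': "\<And>u. u \<in> T \<times> D \<Longrightarrow>
      (\<Sum>j\<in>J. X u j (s j)) \<le> 2 * sqrt (card J) * (ln (card (T \<times> D)) + 1)"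
    by blast
  have s: "Re (c * (\<Sum>j\<in>J. Y t j (s j))) \<le> 2 * sqrt (card J) * (ln (4 * card T) + 1)"
    if "t \<in> T" "c \<in> D" for t c
    using s'[of "(t, c)"] that D(3)
    by (simp add: X_def card_cartesian_product mult.commute sum_distrib_left Re_sum del: times_complex.sel)
  have "cmod (\<Sum>j\<in>J. Y t j (s j)) \<le> 4 * sqrt (card J) * (ln (4 * card T) + 1)" if "t \<in> T" for t
  proof -
    define w where "w = (\<Sum>j\<in>J. Y t j (s j))"
    define K where "K = 2 * sqrt (card J) * (ln (4 * card T) + 1)"
    have "Re w \<le> K" "- Re w \<le> K" "- Im w \<le> K" "Im w \<le> K"
      using s[OF that, of 1] s[OF that, of "-1"] s[OF that, of "\<i>"] s[OF that, of "-\<i>"]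
      by (simp_all only: D_def w_def[symmetric] K_def[symmetric]) simp_all
    then have "cmod w \<le> 2 * K"
      using cmod_le[of w] by linarith
    then show ?thesis by (simp add: w_def K_def)
  qed
  then show ?thesis by blast
qed

subsection \<open>Exponential sums over one stage\<close>

lemma cmod_cis_diff_le: "cmod (cis a - cis b) \<le> \<bar>a - b\<bar>"
proof -
  have "cis a - cis b = cis b * (cis (a - b) - 1)"
    by (simp add: right_diff_distrib cis_mult)
  then have "cmod (cis a - cis b) = cmod (cis (a - b) - 1)"
    by (simp add: norm_mult)
  also have "\<dots> \<le> \<bar>a - b\<bar>"
    using iexp_approx1[of "a - b" 0] by (simp add: cis_conv_exp)
  finally show ?thesis .
qed

text \<open>At \<theta> = \<xi> \<open>/ N ^ k\<close> and divided by the cardinality, this is the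
  Fourier transform at \<xi> of the uniform measure on the left endpoints of the cells of stage
  \<open>k\<close>.\<close>

definition expsum :: "nat set \<Rightarrow> real \<Rightarrow> complex" where
  "expsum J \<theta> = (\<Sum>j\<in>J. cis (- (real j * \<theta>)))"

lemma cis_nat_periodic: "cis (- (real m * (\<theta> + 2 * pi * of_int z))) = cis (- (real m * \<theta>))"
proof -
  have "cis (- (real m * (\<theta> + 2 * pi * of_int z))) = cis (- (real m * \<theta>)) * cis (2 * pi * of_int (- (int m * z)))"
    by (subst cis_mult) (simp add: algebra_simps)
  then show ?thesis by (subst (asm) cis_multiple_2pi) auto
qed

lemma cmod_mean_cis_le_1: "cmod ((\<Sum>x\<in>B. cis (f x)) / of_nat (card B)) \<le> 1"
proof -
  have "cmod (\<Sum>x\<in>B. cis (f x)) \<le> (\<Sum>x\<in>B. 1)"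
    by (rule sum_norm_le) simp
  then show ?thesis
    by (simp add: norm_divide divide_le_eq)
qed

text \<open>Lets a finite net of frequencies control all frequencies.\<close>

lemma mean_cis_lipschitz:
  assumes "\<And>x. x \<in> B \<Longrightarrow> m x \<le> M"
  shows "cmod ((\<Sum>x\<in>B. cis (- (real (m x) * \<theta>))) / of_nat (card B)
    - (\<Sum>x\<in>B. cis (- (real (m x) * \<theta>'))) / of_nat (card B)) \<le> real M * \<bar>\<theta> - \<theta>'\<bar>"
proof -
  have "cmod (\<Sum>x\<in>B. cis (- (real (m x) * \<theta>)) - cis (- (real (m x) * \<theta>'))) \<le> (\<Sum>x\<in>B. real M * \<bar>\<theta> - \<theta>'\<bar>)"
  proof (rule sum_norm_le)
    fix x assume "x \<in> B"
    have "cmod (cis (- (real (m x) * \<theta>)) - cis (- (real (m x) * \<theta>'))) \<le> \<bar>real (m x) * (\<theta>' - \<theta>)\<bar>"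
      using cmod_cis_diff_le[of "- (real (m x) * \<theta>)" "- (real (m x) * \<theta>')"] by (simp add: algebra_simps)
    also have "\<dots> \<le> real M * \<bar>\<theta> - \<theta>'\<bar>"
      using assms[OF \<open>x \<in> B\<close>] by (simp add: abs_mult abs_minus_commute mult_right_mono)
    finally show "cmod (cis (- (real (m x) * \<theta>)) - cis (- (real (m x) * \<theta>'))) \<le> real M * \<bar>\<theta> - \<theta>'\<bar>" .
  qed
  then show ?thesis
    by (cases "card B = 0")
      (simp_all add: sum_subtractf diff_divide_distrib[symmetric] norm_divide divide_le_eq mult.commute)
qed

lemma cmod_diff_diff_le:
  assumes "cmod (a - c) \<le> e" "cmod (b - d) \<le> f"
  shows "cmod ((a - b) - (c - d)) \<le> e + f"
proof -
  have "(a - b) - (c - d) = (a - c) - (b - d)" by simp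
  then have "cmod ((a - b) - (c - d)) \<le> cmod (a - c) + cmod (b - d)"
    by (simp only: norm_triangle_ineq4)
  with assms show ?thesis by linarith
qed

lemma sum_cyclic_shift:
  fixes g :: "nat \<Rightarrow> complex"
  shows "(\<Sum>v<N. g ((x + v) mod N)) = (\<Sum>r<N. g r)"
proof (induction x)
  case (Suc x)
  define h where "h v = g ((x + v) mod N)" for v
  have "(\<Sum>v<N. h (Suc v)) + h 0 = (\<Sum>v<N. h v) + h N"
    using sum.lessThan_Suc_shift[of h N] sum.lessThan_Suc[of h N] by (simp add: add.commute)
  moreover have "h N = h 0" by (simp add: h_def)
  ultimately show ?case using Suc by (simp add: h_def)
qed (auto intro: sum.cong)

text \<open>The shift \<open>s j\<close> acts cyclically, so every subcell stays inside its parent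
  \<open>j\<close>, and as the shift runs over a full period each element of \<open>A\<close> visits
  every residue exactly once.\<close>

definition children :: "nat \<Rightarrow> nat set \<Rightarrow> nat set \<Rightarrow> (nat \<Rightarrow> nat) \<Rightarrow> nat set" where
  "children N A J s = (\<lambda>(j, x). N * j + (x + s j) mod N) ` (J \<times> A)"

lemma add_mod_inj:
  fixes x y N v :: nat
  assumes "x < N" "y < N" "(x + v) mod N = (y + v) mod N"
  shows "x = y"
proof -
  have "int N dvd int (x + v) - int (y + v)"
    using assms(3) by (metis of_nat_mod mod_eq_dvd_iff)
  then have "int N dvd int x - int y" by simp
  moreover have "\<bar>int x - int y\<bar> < int N" using assms(1,2) by auto
  ultimately show ?thesis
    using zdvd_not_zless[of "\<bar>int x - int y\<bar>" "int N"] by (cases "x = y") auto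
qed

lemma inj_children:
  fixes N :: nat
  assumes "A \<subseteq> {..<N}"
  shows "inj_on (\<lambda>(j, x). N * j + (x + s j) mod N) (J \<times> A)"
proof (rule inj_onI, clarify)
  fix j x j' x' assume x: "x \<in> A" "x' \<in> A" and eq: "N * j + (x + s j) mod N = N * j' + (x' + s j') mod N"
  have N: "N > 0" using x assms by auto
  have "(N * j + (x + s j) mod N) div N = (N * j' + (x' + s j') mod N) div N"
    by (simp only: eq)
  then have j: "j = j'" using N by simp
  then have "(x + s j) mod N = (x' + s j) mod N" using eq by simp
  then have "x = x'" by (rule add_mod_inj[rotated -1]) (use x assms in auto)
  with j show "j = j' \<and> x = x'" by simp
qed

lemma card_children:
  assumes "A \<subseteq> {..<N}"
  shows "card (children N A J s) = card J * card A"
  unfolding children_def by (subst card_image[OF inj_children[OF assms]]) (simp add: card_cartesian_product)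

lemma children_bound:
  assumes "J \<subseteq> {..<M}" and N: "(N::nat) > 0"
  shows "children N A J s \<subseteq> {..<N * M}"
proof -
  have "N * j + (x + s j) mod N < N * M" if "j \<in> J" for j x
  proof -
    have "N * j + (x + s j) mod N < N * (j + 1)" using assms by simp
    also have "\<dots> \<le> N * M" using assms that by (intro mult_left_mono) auto
    finally show ?thesis .
  qed
  then show ?thesis by (auto simp: children_def)
qed

lemma expsum_children:
  assumes "A \<subseteq> {..<N}"
  shows "expsum (children N A J s) \<theta> = (\<Sum>j\<in>J. \<Sum>x\<in>A. cis (- (real (N * j + (x + s j) mod N) * \<theta>)))"
  unfolding expsum_def children_def
  by (subst sum.reindex[OF inj_children[OF assms]]) (simp add: sum.cartesian_product case_prod_beta)

text \<open>The constant 56 comes from a net of \<open>14 N\<^bsup>2k+1\<^esup>\<close> points in a period and 4 directions.\<close>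

definition dev_const :: "nat \<Rightarrow> real" where
  "dev_const N = 4 * (ln 56 + 2 * ln (real N) + 1) + 1"

text \<open>The subtracted product belongs to the refinement of every cell into all of its
  \<open>N\<close> subcells, which is the average over all shifts. The contributions of the single
  cells therefore have mean zero and modulus at most 2, and the Hoeffding bound applies on a net.
  Integer frequencies give period \<open>2 * pi\<close> in \<theta> and a Lipschitz bound, which
  extend the estimate to all \<theta>.\<close>

lemma ex_shifts:
  assumes N: "N > 0" and A: "A \<subseteq> {..<N}" "A \<noteq> {}" and J: "J \<noteq> {}" "J \<subseteq> {..<N ^ k}"
  shows "\<exists>s. \<forall>\<theta>. cmod (expsum (children N A J s) \<theta> / of_nat (card A)
      - expsum J (real N * \<theta>) * (expsum {..<N} \<theta> / of_nat N))
    \<le> dev_const N * (real k + 1) * sqrt (card J)"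
proof -
  define Y where "Y \<theta> j v =
      (\<Sum>x\<in>A. cis (- (real (N * j + (x + v) mod N) * \<theta>))) / of_nat (card A)
    - (\<Sum>r<N. cis (- (real (N * j + r) * \<theta>))) / of_nat N" for \<theta> j v
  have finA: "finite A" and finJ: "finite J"
    using A J finite_subset by blast+
  have cJ: "card J \<ge> 1" "card J \<le> N ^ k"
    using finJ J card_mono[OF _ J(2)] by (auto simp: Suc_le_eq card_gt_0_iff)
  have cA: "card A > 0" using finA A by (simp add: card_gt_0_iff)
  have f_eq: "expsum (children N A J s) \<theta> / of_nat (card A)
      - expsum J (real N * \<theta>) * (expsum {..<N} \<theta> / of_nat N) = (\<Sum>j\<in>J. Y \<theta> j (s j))" for s \<theta>
  proof -
    have "expsum J (real N * \<theta>) * expsum {..<N} \<theta> = (\<Sum>j\<in>J. \<Sum>r<N. cis (- (real (N * j + r) * \<theta>)))"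
      unfolding expsum_def sum_product by (simp add: cis_mult algebra_simps)
    then show ?thesis
      unfolding expsum_children[OF A(1)] Y_def by (simp add: sum_subtractf sum_divide_distrib)
  qed
  have Y_bnd: "cmod (Y \<theta> j v) \<le> 2" for \<theta> j v
  proof -
    have "cmod (Y \<theta> j v) \<le> 1 + 1"
      unfolding Y_def using cmod_mean_cis_le_1[of _ "{..<N}"] cmod_mean_cis_le_1[of _ A]
      by (intro order_trans[OF norm_triangle_ineq4] add_mono) simp_all
    then show ?thesis by simp
  qed
  have Y_mean: "(\<Sum>v<N. Y \<theta> j v) = 0" for \<theta> j
  proof -
    define g where "g r = cis (- (real (N * j + r) * \<theta>))" for r
    have "(\<Sum>v<N. \<Sum>x\<in>A. g ((x + v) mod N)) = of_nat (card A) * (\<Sum>r<N. g r)"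
      by (subst sum.swap) (simp add: sum_cyclic_shift)
    then have "(\<Sum>v<N. (\<Sum>x\<in>A. g ((x + v) mod N)) / of_nat (card A)) = (\<Sum>r<N. g r)"
      using cA by (simp add: sum_divide_distrib[symmetric])
    then show ?thesis
      using N unfolding Y_def g_def[symmetric] by (simp add: sum_subtractf)
  qed
  have Y_lip: "cmod (Y \<theta> j v - Y \<theta>' j v) \<le> 2 * real (N ^ Suc k) * \<bar>\<theta> - \<theta>'\<bar>" if "j \<in> J" for \<theta> \<theta>' j v
  proof -
    have le: "N * j + r \<le> N ^ Suc k" if "r < N" for r
    proof -
      have "N * j + r \<le> N * (j + 1)" using that by simp
      also have "\<dots> \<le> N * N ^ k" using J \<open>j \<in> J\<close> by (intro mult_left_mono) auto
      finally show ?thesis by simp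
    qed
    have "cmod (Y \<theta> j v - Y \<theta>' j v) \<le> real (N ^ Suc k) * \<bar>\<theta> - \<theta>'\<bar> + real (N ^ Suc k) * \<bar>\<theta> - \<theta>'\<bar>"
      unfolding Y_def
    proof (rule cmod_diff_diff_le)
      show "cmod ((\<Sum>x\<in>A. cis (- (real (N * j + (x + v) mod N) * \<theta>))) / of_nat (card A)
          - (\<Sum>x\<in>A. cis (- (real (N * j + (x + v) mod N) * \<theta>'))) / of_nat (card A))
        \<le> real (N ^ Suc k) * \<bar>\<theta> - \<theta>'\<bar>"
        using N le by (intro mean_cis_lipschitz) simp
      show "cmod ((\<Sum>r<N. cis (- (real (N * j + r) * \<theta>))) / of_nat N
          - (\<Sum>r<N. cis (- (real (N * j + r) * \<theta>'))) / of_nat N)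
        \<le> real (N ^ Suc k) * \<bar>\<theta> - \<theta>'\<bar>"
        using mean_cis_lipschitz[of "{..<N}" "\<lambda>r. N * j + r" "N ^ Suc k" \<theta> \<theta>'] le
        by (simp only: card_lessThan lessThan_iff)
    qed
    then show ?thesis by (simp only: mult.assoc mult_2 distrib_right)
  qed
  \<comment> \<open>At most \<open>N ^ k\<close> terms with Lipschitz constant
    \<open>2 * N ^ (k + 1)\<close> change over a mesh \<open>2 * pi / n\<close> by at most
    \<open>4 * pi / 14\<close>, which is below 1.\<close>
  define n where "n = 14 * N ^ (2 * k + 1)"
  have n: "n > 0" using N by (simp add: n_def)
  define h where "h = 2 * pi / real n"
  have h: "h > 0" using n by (simp add: h_def)
  have "\<exists>s. \<forall>t\<in>{..<n}. cmod (\<Sum>j\<in>J. Y (h * real t) j (s j)) \<le> 4 * sqrt (card J) * (ln (4 * card {..<n}) + 1)"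
    using n N finJ J Y_bnd Y_mean by (intro simultaneous_hoeffding_complex[of _ _ N]) auto
  then obtain s where s: "\<And>t. t < n \<Longrightarrow> cmod (\<Sum>j\<in>J. Y (h * real t) j (s j)) \<le> 4 * sqrt (card J) * (ln (4 * n) + 1)"
    by auto
  \<comment> \<open>The net grows only exponentially in \<open>k\<close>, so the union bound costs a
    factor linear in \<open>k\<close>.\<close>
  have "ln (real (4 * n)) = ln 56 + (2 * real k + 1) * ln (real N)"
    using N by (simp add: n_def ln_mult ln_realpow algebra_simps)
  also have "\<dots> \<le> (ln 56 + 2 * ln (real N)) * (real k + 1)"
    using N by (simp add: algebra_simps)
  finally have ln_le: "ln (4 * n) + 1 \<le> (ln 56 + 2 * ln (real N) + 1) * (real k + 1)"
    by (simp add: algebra_simps)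
  have "cmod (\<Sum>j\<in>J. Y \<theta> j (s j)) \<le> dev_const N * (real k + 1) * sqrt (card J)" for \<theta>
  proof -
    define i where "i = \<lfloor>\<theta> / h\<rfloor>"
    have i: "\<bar>\<theta> - h * of_int i\<bar> \<le> h"
      using h floor_correct[of "\<theta> / h"] unfolding i_def[symmetric]
      by (simp add: field_simps abs_le_iff)
    \<comment> \<open>By periodicity the grid point \<open>h * i\<close> is equivalent to one of the
      \<open>n\<close> points already tested.\<close>
    define t where "t = nat (i mod int n)"
    have t: "t < n" "int t = i mod int n"
      using n by (simp_all add: t_def nat_less_iff)
    have "i = int t + int n * (i div int n)"
      unfolding t(2) by simp
    then have "h * of_int i = h * (real t + real n * of_int (i div int n))"
      by (metis of_int_add of_int_mult of_int_of_nat_eq)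
    also have "\<dots> = h * real t + 2 * pi * of_int (i div int n)"
      using n by (simp add: h_def field_simps)
    finally have hi: "h * of_int i = h * real t + 2 * pi * of_int (i div int n)" .
    have Yi: "Y (h * of_int i) j v = Y (h * real t) j v" for j v
      unfolding Y_def hi cis_nat_periodic ..
    have "cmod (\<Sum>j\<in>J. Y \<theta> j (s j) - Y (h * real t) j (s j)) \<le> (\<Sum>j\<in>J. 2 * real (N ^ Suc k) * h)"
      unfolding Yi[symmetric]
      by (intro sum_norm_le order_trans[OF Y_lip] mult_left_mono i) auto
    also have "\<dots> \<le> real (N ^ k) * (2 * real (N ^ Suc k) * h)"
      using cJ h of_nat_mono[OF cJ(2)] by (simp add: mult_right_mono)
    also have "\<dots> = 4 * pi / 14"
      using N by (simp add: h_def n_def power_add power_mult power2_eq_square field_simps)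
    also have "\<dots> \<le> 1"
      using pi_less_4 pi_approx by simp
    finally have close: "cmod (\<Sum>j\<in>J. Y \<theta> j (s j) - Y (h * real t) j (s j)) \<le> 1" .
    have "cmod (\<Sum>j\<in>J. Y \<theta> j (s j)) \<le> cmod (\<Sum>j\<in>J. Y \<theta> j (s j) - Y (h * real t) j (s j)) + cmod (\<Sum>j\<in>J. Y (h * real t) j (s j))"
      by (simp add: sum_subtractf) norm
    also have "\<dots> \<le> (real k + 1) * sqrt (card J) + 4 * sqrt (card J) * ((ln 56 + 2 * ln (real N) + 1) * (real k + 1))"
    proof (rule add_mono)
      have "1 * 1 \<le> (real k + 1) * sqrt (card J)" using cJ by (intro mult_mono) auto
      with close show "cmod (\<Sum>j\<in>J. Y \<theta> j (s j) - Y (h * real t) j (s j)) \<le> (real k + 1) * sqrt (card J)" by linarith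
      show "cmod (\<Sum>j\<in>J. Y (h * real t) j (s j)) \<le> 4 * sqrt (card J) * ((ln 56 + 2 * ln (real N) + 1) * (real k + 1))"
        by (rule order_trans[OF s[OF t(1)] mult_left_mono[OF ln_le]]) simp
    qed
    also have "\<dots> = dev_const N * (real k + 1) * sqrt (card J)"
      by (simp add: dev_const_def algebra_simps)
    finally show ?thesis .
  qed
  then show ?thesis unfolding f_eq by blast
qed

subsection \<open>Fourier decay of the stages\<close>

text \<open>The Fourier transform of the uniform distribution on the unit interval; the value at \<open>u = 0\<close> is
  junk.\<close>

definition unif_hat :: "real \<Rightarrow> complex" where
  "unif_hat u = (1 - cis (- u)) / (\<i> * of_real u)"

text \<open>Interpolates between the bounds 1 and \<open>2 / \<bar>u\<bar>\<close>.\<close>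

lemma unif_hat_le_powr:
  assumes "u \<noteq> 0" "0 \<le> \<gamma>" "\<gamma> \<le> 1"
  shows "cmod (unif_hat u) \<le> (2 / \<bar>u\<bar>) powr \<gamma>"
proof (cases "2 / \<bar>u\<bar> \<ge> 1")
  case True
  have "cmod (unif_hat u) \<le> 1"
    using cmod_cis_diff_le[of 0 "- u"] assms(1) by (simp add: unif_hat_def norm_divide norm_mult divide_le_eq)
  also have "1 \<le> (2 / \<bar>u\<bar>) powr \<gamma>"
    using True assms(2) by (rule ge_one_powr_ge_zero)
  finally show ?thesis .
next
  case False
  have "cmod (1 - cis (- u)) \<le> 2"
    using norm_triangle_ineq4[of 1 "cis (- u)"] by simp
  then have "cmod (unif_hat u) \<le> (2 / \<bar>u\<bar>) powr 1"
    using assms(1) by (simp add: unif_hat_def norm_divide norm_mult divide_right_mono)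
  also have "\<dots> \<le> (2 / \<bar>u\<bar>) powr \<gamma>"
    using False assms(3) by (intro powr_mono') auto
  finally show ?thesis .
qed

text \<open>Allows the interval factor to be divided out at frequencies up to the inverse cell
  length.\<close>

lemma unif_hat_ge_half:
  assumes "u \<noteq> 0" "\<bar>u\<bar> \<le> 1"
  shows "1 / 2 \<le> cmod (unif_hat u)"
proof -
  have "cmod (cis (- u) - 1 + \<i> * of_real u) \<le> \<bar>u\<bar>\<^sup>2 / 2"
    using iexp_approx1[of "- u" 1] by (simp add: cis_conv_exp algebra_simps eval_nat_numeral)
  also have "\<dots> \<le> \<bar>u\<bar> * 1 / 2"
    unfolding power2_eq_square using assms by (intro divide_right_mono mult_left_mono) auto
  finally have "cmod (cis (- u) - 1 + \<i> * of_real u) \<le> \<bar>u\<bar> / 2" by simp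
  moreover have "cmod (\<i> * of_real u) \<le> cmod (cis (- u) - 1 + \<i> * of_real u) + cmod (1 - cis (- u))"
    using norm_triangle_ineq[of "cis (- u) - 1 + \<i> * of_real u" "1 - cis (- u)"] by simp
  ultimately have "\<bar>u\<bar> / 2 \<le> cmod (1 - cis (- u))"
    by (simp add: norm_mult)
  then show ?thesis
    using assms(1) by (simp add: unif_hat_def norm_divide norm_mult field_simps)
qed

text \<open>An interval is the union of \<open>N\<close> translates of an interval \<open>N\<close>
  times shorter; the sum over the translates is geometric with ratio
  \<open>cis (- u)\<close>.\<close>

lemma unif_hat_mult:
  assumes "N > 0" "u \<noteq> 0"
  shows "unif_hat (real N * u) = unif_hat u * (expsum {..<N} u / of_nat N)"
proof -
  have pow: "cis (- (real r * u)) = cis (- u) ^ r" for r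
    using Complex.DeMoivre[of "- u" r] by simp
  have "1 - cis (- (real N * u)) = (1 - cis (- u)) * expsum {..<N} u"
    unfolding expsum_def pow by (rule one_diff_power_eq)
  then show ?thesis
    using assms by (simp add: unif_hat_def)
qed

text \<open>The sequence of sets \<open>J k\<close> describes the \<open>k\<close>-th stage of a Cantor-like construction: the union of the
  intervals \<open>[j / N ^ k, (j + 1) / N ^ k]\<close> for \<open>j \<in> J k\<close>.\<close>

definition cantor_stages :: "nat \<Rightarrow> nat set \<Rightarrow> (nat \<Rightarrow> nat set) \<Rightarrow> bool" where
  "cantor_stages N A J \<longleftrightarrow> N > 0 \<and> A \<subseteq> {..<N} \<and> A \<noteq> {} \<and> J 0 = {0} \<and>
     (\<forall>k. \<exists>s. J (Suc k) = children N A (J k) s)"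

lemma cantor_stages_props:
  assumes "cantor_stages N A J"
  shows "J k \<subseteq> {..<N ^ k}" and "card (J k) = card A ^ k" and "finite (J k)" and "J k \<noteq> {}"
proof -
  have *: "J k \<subseteq> {..<N ^ k} \<and> card (J k) = card A ^ k"
  proof (induction k)
    case (Suc k)
    have "\<exists>s. J (Suc k) = children N A (J k) s"
      using assms by (simp add: cantor_stages_def)
    then obtain s where s: "J (Suc k) = children N A (J k) s" ..
    have "A \<subseteq> {..<N}" "N > 0"
      using assms by (simp_all add: cantor_stages_def)
    with Suc show ?case
      using children_bound[of "J k" "N ^ k" N A s] unfolding s by (simp add: card_children)
  qed (use assms in \<open>simp add: cantor_stages_def\<close>)
  then show "J k \<subseteq> {..<N ^ k}" "card (J k) = card A ^ k" by auto
  then show "finite (J k)" using finite_subset by blast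
  have "finite A" "A \<noteq> {}" using assms finite_subset by (auto simp: cantor_stages_def)
  with * show "J k \<noteq> {}" by (auto simp: card_eq_0_iff)
qed

text \<open>The shifts of a stage depend on the set built so far, hence dependent choice:
  \<open>P\<close> carries the invariants that \<open>ex_shifts\<close> needs, and \<open>Q\<close>
  records the step and its estimate.\<close>

lemma ex_random_cantor_stages:
  assumes N: "N > 0" and A: "A \<subseteq> {..<N}" "A \<noteq> {}"
  shows "\<exists>J. cantor_stages N A J \<and> (\<forall>k \<theta>.
      cmod (expsum (J (Suc k)) \<theta> / of_nat (card A) - expsum (J k) (real N * \<theta>) * (expsum {..<N} \<theta> / of_nat N))
    \<le> dev_const N * (real k + 1) * sqrt (card A ^ k))"
proof -
  define P where "P k J \<longleftrightarrow> J \<noteq> {} \<and> J \<subseteq> {..<N ^ k} \<and> card J = card A ^ k \<and> (k = 0 \<longrightarrow> J = {0})" for k and J :: "nat set"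
  define Q where "Q k J J' \<longleftrightarrow> (\<exists>s. J' = children N A J s) \<and> (\<forall>\<theta>.
      cmod (expsum J' \<theta> / of_nat (card A) - expsum J (real N * \<theta>) * (expsum {..<N} \<theta> / of_nat N))
    \<le> dev_const N * (real k + 1) * sqrt (card A ^ k))" for k J J'
  have "\<exists>J. \<forall>k. P k (J k) \<and> Q k (J k) (J (Suc k))"
  proof (rule dependent_nat_choice)
    show "\<exists>J. P 0 J" by (auto simp: P_def)
  next
    fix J k assume J: "P k J"
    then obtain s where s: "\<And>\<theta>. cmod (expsum (children N A J s) \<theta> / of_nat (card A)
        - expsum J (real N * \<theta>) * (expsum {..<N} \<theta> / of_nat N))
      \<le> dev_const N * (real k + 1) * sqrt (card J)"
      using ex_shifts[OF N A, of J k] by (auto simp: P_def)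
    have "children N A J s \<noteq> {}"
      using J A by (simp add: children_def P_def)
    then have "P (Suc k) (children N A J s)"
      using J children_bound[of J "N ^ k" N A s] N card_children[OF A(1), of J s] by (simp add: P_def)
    moreover have "Q k J (children N A J s)"
      using s J by (auto simp: P_def Q_def)
    ultimately show "\<exists>J'. P (Suc k) J' \<and> Q k J J'" by blast
  qed
  then obtain J where "\<And>k. P k (J k)" "\<And>k. Q k (J k) (J (Suc k))" by blast
  then show ?thesis
    using N A by (intro exI[of _ J]) (auto simp: P_def Q_def cantor_stages_def)
qed

text \<open>Point masses are first replaced by uniform masses on the cells, which turns the estimate
  \<open>dev\<close> into a bound for consecutive differences. These telescope to a convergent
  series times the required power of \<xi>, and at frequencies up to \<open>N ^ k\<close> the
  smoothing is undone at the cost of a factor 2.\<close>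

lemma expsum_decay:
  assumes stages: "cantor_stages N A J"
    and dev: "\<And>k \<theta>. cmod (expsum (J (Suc k)) \<theta> / of_nat (card A)
        - expsum (J k) (real N * \<theta>) * (expsum {..<N} \<theta> / of_nat N)) \<le> dev_const N * (real k + 1) * sqrt (card A ^ k)"
    and \<alpha>: "0 < \<alpha>" "\<alpha> < 1" and large: "real N powr \<alpha> < real (card A)"
  shows "\<exists>B>0. \<forall>\<xi> k. \<xi> \<noteq> 0 \<longrightarrow> \<bar>\<xi>\<bar> \<le> real N ^ k \<longrightarrow>
    cmod (expsum (J k) (\<xi> / real N ^ k) / of_nat (card A ^ k)) \<le> B * \<bar>\<xi>\<bar> powr (- \<alpha> / 2)"
proof -
  define a where "a = real (card A)"
  define \<gamma> where "\<gamma> = \<alpha> / 2"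
  \<comment> \<open>The loss per stage from the interval factor at exponent \<gamma>, against the
    square root saving over \<open>card A\<close> cells. The hypothesis \<open>large\<close> says
    exactly that \<open>r < 1\<close>.\<close>
  define r where "r = real N powr \<gamma> / sqrt a"
  have N: "N > 0" using stages by (simp add: cantor_stages_def)
  have a: "0 < a" using large powr_ge_zero[of "real N" \<alpha>] unfolding a_def by linarith
  have "(real N powr \<gamma>)\<^sup>2 = real N powr \<alpha>"
    using N by (simp add: \<gamma>_def powr_power)
  then have "real N powr \<gamma> < sqrt a"
    using large by (intro real_less_rsqrt) (simp add: a_def)
  then have r: "0 < r" "r < 1"
    using a N by (auto simp: r_def)
  \<comment> \<open>The sum of \<open>(k + 1) * r ^ k\<close>, the derivative of the geometric
    series.\<close>
  define S where "S = 1 / (1 - r)\<^sup>2"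
  have sums: "(\<lambda>n. real (Suc n) * r ^ n) sums S"
    unfolding S_def using r by (intro geometric_deriv_sums) simp
  have sum_le: "(\<Sum>k<K. (real k + 1) * r ^ k) \<le> S" for K
    using sum_le_suminf[OF sums_summable[OF sums], of "{..<K}"] sums_unique[OF sums] r
    by (simp add: add.commute)
  define D where "D = dev_const N"
  have D: "D > 0"
    unfolding D_def dev_const_def using N by (intro add_nonneg_pos mult_nonneg_nonneg) (auto intro!: add_nonneg_nonneg)
  define B0 where "B0 = 2 powr \<gamma> + (2 * real N) powr \<gamma> * D * S"
  have "B0 > 0"
    unfolding B0_def S_def using D r by (intro add_pos_nonneg) auto
  have "cmod (expsum (J K) (\<xi> / real N ^ K) / of_nat (card A ^ K)) \<le> 2 * B0 * \<bar>\<xi>\<bar> powr (- \<alpha> / 2)"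
    if \<xi>: "\<xi> \<noteq> 0" "\<bar>\<xi>\<bar> \<le> real N ^ K" for \<xi> K
  proof -
    \<comment> \<open>The Fourier transform at \<xi> of the uniform distribution on the union of the
      cells of stage \<open>k\<close>.\<close>
    define G where "G k = unif_hat (\<xi> / real N ^ k) * (expsum (J k) (\<xi> / real N ^ k) / of_nat (card A ^ k))" for k
    have step: "cmod (G (Suc k) - G k) \<le> (2 * real N) powr \<gamma> * D * \<bar>\<xi>\<bar> powr (- \<gamma>) * ((real k + 1) * r ^ k)" for k
    proof -
      define \<theta> where "\<theta> = \<xi> / real N ^ Suc k"
      have \<theta>: "\<theta> \<noteq> 0" "\<xi> / real N ^ k = real N * \<theta>" using \<xi> N by (auto simp: \<theta>_def)
      have "G (Suc k) - G k = unif_hat \<theta> * (expsum (J (Suc k)) \<theta> / of_nat (card A)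
          - expsum (J k) (real N * \<theta>) * (expsum {..<N} \<theta> / of_nat N)) / of_nat (card A ^ k)"
        unfolding G_def \<theta>(2) \<theta>_def[symmetric] unif_hat_mult[OF N \<theta>(1)]
        by (simp add: algebra_simps diff_divide_distrib)
      then have "cmod (G (Suc k) - G k) = cmod (unif_hat \<theta>) * cmod (expsum (J (Suc k)) \<theta> / of_nat (card A)
          - expsum (J k) (real N * \<theta>) * (expsum {..<N} \<theta> / of_nat N)) / a ^ k"
        by (simp add: norm_mult norm_divide norm_power a_def)
      also have "\<dots> \<le> (2 / \<bar>\<theta>\<bar>) powr \<gamma> * (D * (real k + 1) * sqrt (card A ^ k)) / a ^ k"
        using a unif_hat_le_powr[OF \<theta>(1), of \<gamma>] \<alpha> dev[of k \<theta>]
        by (intro divide_right_mono mult_mono) (auto simp: \<gamma>_def D_def)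
      also have "2 / \<bar>\<theta>\<bar> = (2 * real N) * real N ^ k / \<bar>\<xi>\<bar>"
        using N by (simp add: \<theta>_def abs_divide)
      also have "\<dots> powr \<gamma> = (2 * real N) powr \<gamma> * (real N powr \<gamma>) ^ k * \<bar>\<xi>\<bar> powr (- \<gamma>)"
        using N by (simp add: powr_divide powr_mult powr_power powr_realpow[symmetric] powr_powr mult.commute)
          (simp add: powr_minus divide_inverse)
      also have "sqrt (card A ^ k) = sqrt a ^ k"
        by (simp add: a_def real_sqrt_power)
      also have "(2 * real N) powr \<gamma> * (real N powr \<gamma>) ^ k * \<bar>\<xi>\<bar> powr (- \<gamma>) * (D * (real k + 1) * sqrt a ^ k) / a ^ k
          = (2 * real N) powr \<gamma> * D * \<bar>\<xi>\<bar> powr (- \<gamma>) * ((real k + 1) * r ^ k)"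
      proof -
        have "a ^ k = sqrt a ^ k * sqrt a ^ k"
          using a by (simp flip: power_mult_distrib)
        then show ?thesis
          using a by (simp add: r_def power_divide field_simps)
      qed
      finally show ?thesis .
    qed
    have "cmod (G K) \<le> cmod (G 0) + (\<Sum>k<K. cmod (G (Suc k) - G k))"
    proof (induction K)
      case (Suc K)
      have "cmod (G (Suc K)) \<le> cmod (G K) + cmod (G (Suc K) - G K)"
        using norm_triangle_ineq[of "G K" "G (Suc K) - G K"] by simp
      with Suc show ?case by simp
    qed simp
    also have "\<dots> \<le> 2 powr \<gamma> * \<bar>\<xi>\<bar> powr (- \<gamma>) + (\<Sum>k<K. (2 * real N) powr \<gamma> * D * \<bar>\<xi>\<bar> powr (- \<gamma>) * ((real k + 1) * r ^ k))"
    proof (intro add_mono sum_mono step)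
      have "J 0 = {0}" using stages by (simp add: cantor_stages_def)
      then have "G 0 = unif_hat \<xi>" by (simp add: G_def expsum_def)
      also have "cmod \<dots> \<le> (2 / \<bar>\<xi>\<bar>) powr \<gamma>"
        using \<xi> \<alpha> by (intro unif_hat_le_powr) (auto simp: \<gamma>_def)
      also have "\<dots> = 2 powr \<gamma> * \<bar>\<xi>\<bar> powr (- \<gamma>)"
        by (simp add: powr_divide) (simp add: powr_minus divide_inverse)
      finally show "cmod (G 0) \<le> 2 powr \<gamma> * \<bar>\<xi>\<bar> powr (- \<gamma>)" .
    qed
    also have "\<dots> = 2 powr \<gamma> * \<bar>\<xi>\<bar> powr (- \<gamma>) + (2 * real N) powr \<gamma> * D * \<bar>\<xi>\<bar> powr (- \<gamma>) * (\<Sum>k<K. (real k + 1) * r ^ k)"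
      by (simp only: sum_distrib_left)
    also have "\<dots> \<le> 2 powr \<gamma> * \<bar>\<xi>\<bar> powr (- \<gamma>) + (2 * real N) powr \<gamma> * D * \<bar>\<xi>\<bar> powr (- \<gamma>) * S"
      using D by (intro add_left_mono mult_left_mono sum_le) auto
    also have "\<dots> = B0 * \<bar>\<xi>\<bar> powr (- \<gamma>)"
      by (simp add: B0_def algebra_simps)
    finally have GK: "cmod (G K) \<le> B0 * \<bar>\<xi>\<bar> powr (- \<gamma>)" .
    have half: "1 / 2 \<le> cmod (unif_hat (\<xi> / real N ^ K))"
      using \<xi> N by (intro unif_hat_ge_half) auto
    have "1 / 2 * cmod (expsum (J K) (\<xi> / real N ^ K) / of_nat (card A ^ K)) \<le> cmod (G K)"
      unfolding G_def norm_mult by (rule mult_right_mono[OF half]) simp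
    with GK have "cmod (expsum (J K) (\<xi> / real N ^ K) / of_nat (card A ^ K)) \<le> 2 * B0 * \<bar>\<xi>\<bar> powr (- \<gamma>)"
      by linarith
    then show ?thesis by (simp add: \<gamma>_def)
  qed
  with \<open>B0 > 0\<close> show ?thesis
    by (intro exI[of _ "2 * B0"]) auto
qed

subsection \<open>The limit set and its measure\<close>

definition cantor_set :: "nat \<Rightarrow> (nat \<Rightarrow> nat set) \<Rightarrow> real set" where
  "cantor_set N J = (\<Inter>k. \<Union>j\<in>J k. {real j / real N ^ k .. (real j + 1) / real N ^ k})"

section \<open>Cells, addresses and the exclusion of solutions\<close>

lemma mem_cell_iff:
  assumes "N > 0"
  shows "x \<in> {real j / real N ^ k .. (real j + 1) / real N ^ k} \<longleftrightarrow>
    real j \<le> x * real N ^ k \<and> x * real N ^ k \<le> real j + 1"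
  using assms by (simp add: divide_le_eq le_divide_eq)

lemma parent_cell:
  assumes "N > 0" "r < N" and "real (N * j + r) \<le> x * real N ^ Suc k" "x * real N ^ Suc k \<le> real (N * j + r) + 1"
  shows "real j \<le> x * real N ^ k \<and> x * real N ^ k \<le> real j + 1"
proof -
  have "real N * real j \<le> real N * (x * real N ^ k)"
    using assms(3) by (simp add: mult_ac)
  moreover have "real N * (x * real N ^ k) \<le> real N * (real j + 1)"
    using assms(2,4) by (simp add: algebra_simps)
  ultimately show ?thesis
    using assms(1) by simp
qed

text \<open>The coefficients \<open>q\<close>, \<open>p - q\<close>, \<open>- p\<close> add up to
  zero, so the shift \<open>v\<close> cancels; the carries \<open>d\<close> are collected in the
  multiple of \<open>N\<close> that \<open>avoiding\<close> tolerates.\<close>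

lemma avoiding_shifted:
  assumes av: "avoiding p N A" and q: "0 < q" "q < p" and abc: "a \<in> A" "b \<in> A" "c \<in> A"
    and small: "\<bar>int q * int ((a + v) mod N) + (int p - int q) * int ((b + v) mod N) - int p * int ((c + v) mod N)\<bar> \<le> int p + 1"
  shows "a = b \<and> b = c"
proof -
  define d where "d w = int ((w + v) div N)" for w
  have m: "int ((w + v) mod N) = int w + int v - int N * d w" for w
    unfolding d_def by (simp add: zmod_int zdiv_int minus_mult_div_eq_mod)
  have "\<bar>int q * int a + (int p - int q) * int b - int p * int c
      - (int q * d a + (int p - int q) * d b - int p * d c) * int N\<bar> \<le> int p + 1"
    using small unfolding m by (simp add: algebra_simps)
  then show ?thesis
    using av q abc unfolding avoiding_def by blast
qed

lemma cantor_stages_Suc: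
  assumes "cantor_stages N A J"
  obtains s where "J (Suc k) = children N A (J k) s"
proof -
  have "\<exists>s. J (Suc k) = children N A (J k) s"
    using assms by (simp add: cantor_stages_def)
  then show ?thesis using that by blast
qed

text \<open>Distinct closed cells of one stage are disjoint, so points of the Cantor set have unique
  addresses.\<close>

lemma cells_separated:
  assumes st: "cantor_stages N A J" and av: "avoiding p N A" and p: "p \<ge> 2"
  shows "i \<in> J k \<Longrightarrow> j \<in> J k \<Longrightarrow> i < j \<Longrightarrow> i + 2 \<le> j"
proof (induction k arbitrary: i j)
  case 0
  then show ?case using st by (simp add: cantor_stages_def)
next
  case (Suc k)
  have N: "N > 0" using st by (simp add: cantor_stages_def)
  obtain s where s: "J (Suc k) = children N A (J k) s"
    by (rule cantor_stages_Suc[OF st])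
  obtain i' a where i: "i = N * i' + (a + s i') mod N" "i' \<in> J k" "a \<in> A"
    using Suc.prems(1) unfolding s children_def by auto
  obtain j' b where j: "j = N * j' + (b + s j') mod N" "j' \<in> J k" "b \<in> A"
    using Suc.prems(2) unfolding s children_def by auto
  show ?case
  proof (rule ccontr)
    assume "\<not> i + 2 \<le> j"
    then have ij: "j = i + 1" using Suc.prems(3) by simp
    \<comment> \<open>Distinct parents are two apart by induction, which leaves a gap of at least
      \<open>N\<close> indices between their subcells.\<close>
    have "i' = j'"
    proof (rule ccontr)
      assume "i' \<noteq> j'"
      moreover have "i' \<le> j'"
      proof -
        have "i div N = i'" "j div N = j'" using N by (simp_all add: i j)
        then show ?thesis using div_le_mono[of i j N] ij by simp
      qed
      ultimately have "i' + 2 \<le> j'" using Suc.IH[OF i(2) j(2)] by simp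
      then have "N * (i' + 2) \<le> N * j'" by (rule mult_le_mono2)
      moreover have "(a + s i') mod N < N" using N by simp
      ultimately have "i + N < j" by (simp add: i(1) j(1) algebra_simps)
      with ij N show False by simp
    qed
    then have "int ((a + s i') mod N) - int ((b + s i') mod N) = - 1"
      using ij by (simp add: i(1) j(1))
    \<comment> \<open>Neighbouring subcells of one parent form an approximate solution with
      \<open>q = 1\<close> and equal second and third entries.\<close>
    then have "\<bar>int 1 * int ((a + s i') mod N) + (int p - int 1) * int ((b + s i') mod N)
        - int p * int ((b + s i') mod N)\<bar> \<le> int p + 1"
      by (simp add: algebra_simps)
    then have "a = b"
      using avoiding_shifted[OF av, of 1 a b b "s i'"] p i j by simp
    with \<open>i' = j'\<close> ij i j show False by simp
  qed
qed

lemma cell_unique: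
  assumes st: "cantor_stages N A J" and av: "avoiding p N A" and p: "p \<ge> 2"
    and "i \<in> J k" "j \<in> J k"
    and "real i \<le> x" "x \<le> real i + 1" "real j \<le> x" "x \<le> real j + 1"
  shows "i = j"
  using cells_separated[OF st av p, of i k j] cells_separated[OF st av p, of j k i] assms(4-)
  by (cases i j rule: linorder_cases) auto

text \<open>At scale \<open>N ^ (k + 1)\<close>, replacing \<open>t\<close> by \<open>q / p\<close>
  costs at most 1, by the bound on \<open>t\<close> and because points of a common cell of stage
  \<open>k\<close> are then at most \<open>N\<close> apart. Moving the points to the left endpoints
  of their subcells costs at most \<open>p\<close>, since the weights on either side of the equation
  add up to \<open>p\<close>. The total \<open>p + 1\<close> is the slack in
  \<open>avoiding\<close>.\<close>

lemma cantor_common_cell: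
  assumes st: "cantor_stages N A J" and av: "avoiding p N A" and p: "p \<ge> 2"
    and xyz: "x \<in> cantor_set N J" "y \<in> cantor_set N J" "z \<in> cantor_set N J"
    and q: "0 < q" "q < p" and t: "\<bar>t - real q / real p\<bar> < 1 / (real p * real N)"
    and eq: "t * x + (1 - t) * y = z"
  shows "\<exists>j\<in>J k. \<forall>w\<in>{x, y, z}. real j \<le> w * real N ^ k \<and> w * real N ^ k \<le> real j + 1"
proof (induction k)
  have N: "N > 0" using st by (simp add: cantor_stages_def)
  have cell: "\<exists>j\<in>J k. real j \<le> w * real N ^ k \<and> w * real N ^ k \<le> real j + 1" if "w \<in> {x, y, z}" for w k
  proof -
    have "w \<in> cantor_set N J" using that xyz by blast
    then have "w \<in> (\<Union>j\<in>J k. {real j / real N ^ k .. (real j + 1) / real N ^ k})"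
      unfolding cantor_set_def by blast
    then show ?thesis by (simp only: UN_iff mem_cell_iff[OF N])
  qed
  {
    case 0
    show ?case using cell[of _ 0] st by (auto simp: cantor_stages_def)
  next
    case (Suc k)
    then obtain j where j: "j \<in> J k"
      "\<And>w. w \<in> {x, y, z} \<Longrightarrow> real j \<le> w * real N ^ k \<and> w * real N ^ k \<le> real j + 1" by blast
    obtain s where s: "J (Suc k) = children N A (J k) s"
      by (rule cantor_stages_Suc[OF st])
    define r where "r a = (a + s j) mod N" for a
    have child: "\<exists>a\<in>A. N * j + r a \<in> J (Suc k) \<and> real (N * j + r a) \<le> w * real N ^ Suc k \<and> w * real N ^ Suc k \<le> real (N * j + r a) + 1"
      if w: "w \<in> {x, y, z}" for w
    proof -
      obtain i where i: "i \<in> J (Suc k)" "real i \<le> w * real N ^ Suc k" "w * real N ^ Suc k \<le> real i + 1"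
        using cell[OF w] by blast
      obtain i' a where i': "i = N * i' + (a + s i') mod N" "i' \<in> J k" "a \<in> A"
        using i(1) unfolding s children_def by auto
      have "real i' \<le> w * real N ^ k \<and> w * real N ^ k \<le> real i' + 1"
        using N i unfolding i'(1) by (intro parent_cell) auto
      then have "i' = j"
        using cell_unique[OF st av p i'(2) j(1)] j(2)[OF w] by blast
      with i i' show ?thesis unfolding r_def by blast
    qed
    obtain a where a: "a \<in> A" "N * j + r a \<in> J (Suc k)"
      "real (N * j + r a) \<le> x * real N ^ Suc k" "x * real N ^ Suc k \<le> real (N * j + r a) + 1"
      using child[of x] by blast
    obtain b where b: "b \<in> A" "real (N * j + r b) \<le> y * real N ^ Suc k" "y * real N ^ Suc k \<le> real (N * j + r b) + 1"
      using child[of y] by blast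
    obtain c where c: "c \<in> A" "real (N * j + r c) \<le> z * real N ^ Suc k" "z * real N ^ Suc k \<le> real (N * j + r c) + 1"
      using child[of z] by blast
    define X Y Z where XYZ: "X = x * real N ^ Suc k" "Y = y * real N ^ Suc k" "Z = z * real N ^ Suc k"
    have ratio: "\<bar>real q - real p * t\<bar> < 1 / real N"
    proof -
      have "real p * \<bar>t - real q / real p\<bar> < real p * (1 / (real p * real N))"
        using t p by (intro mult_strict_left_mono) auto
      moreover have "\<bar>real q - real p * t\<bar> = real p * \<bar>t - real q / real p\<bar>"
        using p by (simp add: abs_if field_simps)
      ultimately show ?thesis using p by simp
    qed
    have "real q * X + (real p - real q) * Y - real p * Z = (real q - real p * t) * (X - Y)"
      unfolding XYZ eq[symmetric] by (simp add: algebra_simps)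
    moreover have "\<bar>X - Y\<bar> \<le> real N"
    proof -
      have "\<bar>x * real N ^ k - y * real N ^ k\<bar> \<le> 1" using j(2)[of x] j(2)[of y] by (simp add: abs_le_iff)
      then have "real N * \<bar>x * real N ^ k - y * real N ^ k\<bar> \<le> real N * 1" by (rule mult_left_mono) simp
      moreover have "X - Y = real N * (x * real N ^ k - y * real N ^ k)"
        unfolding XYZ by (simp add: algebra_simps)
      ultimately show ?thesis by (simp add: abs_mult)
    qed
    then have "\<bar>real q - real p * t\<bar> * \<bar>X - Y\<bar> \<le> 1 / real N * real N"
      using ratio by (intro mult_mono) auto
    ultimately have "\<bar>real q * X + (real p - real q) * Y - real p * Z\<bar> \<le> 1"
      using N by (simp add: abs_mult)
    moreover have "real q * real (r a) \<le> real q * (X - real N * real j)" "real q * (X - real N * real j - 1) \<le> real q * real (r a)"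
      "(real p - real q) * real (r b) \<le> (real p - real q) * (Y - real N * real j)"
      "(real p - real q) * (Y - real N * real j - 1) \<le> (real p - real q) * real (r b)"
      "real p * real (r c) \<le> real p * (Z - real N * real j)" "real p * (Z - real N * real j - 1) \<le> real p * real (r c)"
      using a b c q unfolding XYZ by (auto intro!: mult_left_mono)
    ultimately have "\<bar>real q * real (r a) + (real p - real q) * real (r b) - real p * real (r c)\<bar> \<le> real p + 1"
      by (simp add: abs_le_iff algebra_simps)
    then have "real_of_int \<bar>int q * int (r a) + (int p - int q) * int (r b) - int p * int (r c)\<bar> \<le> real_of_int (int p + 1)"
      by simp
    then have "\<bar>int q * int (r a) + (int p - int q) * int (r b) - int p * int (r c)\<bar> \<le> int p + 1"
      by (simp only: of_int_le_iff)
    then have "a = b \<and> b = c"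
      using avoiding_shifted[OF av q a(1) b(1) c(1)] unfolding r_def by blast
    with a b c show ?case by blast
  }
qed

lemma cantor_set_avoids:
  assumes st: "cantor_stages N A J" and N: "N \<ge> 2" and av: "avoiding p N A" and p: "p \<ge> 2"
    and xyz: "x \<in> cantor_set N J" "y \<in> cantor_set N J" "z \<in> cantor_set N J"
    and q: "0 < q" "q < p" and t: "\<bar>t - real q / real p\<bar> < 1 / (real p * real N)"
    and eq: "t * x + (1 - t) * y = z"
  shows "x = y"
proof (rule ccontr)
  assume "x \<noteq> y"
  obtain k where k: "1 / \<bar>x - y\<bar> < real N ^ k"
    using real_arch_pow[of "real N" "1 / \<bar>x - y\<bar>"] N by auto
  obtain j where "real j \<le> x * real N ^ k" "x * real N ^ k \<le> real j + 1"
    "real j \<le> y * real N ^ k" "y * real N ^ k \<le> real j + 1"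
    using cantor_common_cell[OF st av p xyz q t eq, of k] by blast
  then have "\<bar>(x - y) * real N ^ k\<bar> \<le> 1"
    by (simp add: abs_le_iff algebra_simps)
  then have "\<bar>x - y\<bar> * real N ^ k \<le> 1" by (simp add: abs_mult)
  then show False
    using k \<open>x \<noteq> y\<close> by (simp add: field_simps)
qed

section \<open>Existence of the limit measure\<close>

lemma cantor_set_borel:
  assumes "cantor_stages N A J"
  shows "cantor_set N J \<in> sets borel" "cantor_set N J \<subseteq> {0..1}"
proof -
  show "cantor_set N J \<in> sets borel"
    unfolding cantor_set_def using cantor_stages_props(3)[OF assms]
    by (intro sets.countable_INT'' sets.finite_UN) auto
  have "cantor_set N J \<subseteq> (\<Union>j\<in>J 0. {real j / real N ^ 0 .. (real j + 1) / real N ^ 0})"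
    unfolding cantor_set_def by blast
  also have "\<dots> = {0..1}"
    using assms by (simp add: cantor_stages_def)
  finally show "cantor_set N J \<subseteq> {0..1}" .
qed

lemma integral_distr_pmf_of_set:
  fixes f :: "real \<Rightarrow> 'b::{banach, second_countable_topology}"
  assumes "finite S" "S \<noteq> {}" "f \<in> borel_measurable borel"
  shows "integral\<^sup>L (distr (measure_pmf (pmf_of_set S)) borel g) f = (\<Sum>j\<in>S. f (g j)) /\<^sub>R real (card S)"
proof -
  have "integral\<^sup>L (distr (measure_pmf (pmf_of_set S)) borel g) f = (\<integral>j. f (g j) \<partial>measure_pmf (pmf_of_set S))"
    using assms(3) by (subst integral_distr) auto
  also have "\<dots> = (\<Sum>j\<in>S. pmf (pmf_of_set S) j *\<^sub>R f (g j))"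
    using assms by (intro integral_measure_pmf) auto
  finally show ?thesis
    using assms by (simp add: scaleR_sum_right divide_inverse)
qed

lemma fourier_transform_eq_char: "fourier_transform \<mu> \<xi> = char \<mu> (- \<xi>)"
  unfolding fourier_transform_def char_def by (simp add: mult.commute)

text \<open>The measure is a weak subsequential limit of the uniform measures on the left endpoints.
  From stage \<open>k\<close> on these live on the closed set \<open>C k\<close>, so the limit does
  too, and Levy's continuity theorem carries over the transforms.\<close>

lemma ex_cantor_measure:
  assumes st: "cantor_stages N A J"
  shows "\<exists>\<mu> r. real_distribution \<mu> \<and> strict_mono r \<and> measure \<mu> (cantor_set N J) = 1 \<and>
    (\<forall>\<xi>. (\<lambda>n. expsum (J (r n)) (\<xi> / real N ^ r n) / of_nat (card A ^ r n)) \<longlonglongrightarrow> fourier_transform \<mu> \<xi>)"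
proof -
  define M where "M n = distr (measure_pmf (pmf_of_set (J n))) borel (\<lambda>j. real j / real N ^ n)" for n
  define C where "C k = (\<Union>j\<in>J k. {real j / real N ^ k .. (real j + 1) / real N ^ k})" for k
  note props = cantor_stages_props[OF st]
  have N: "N > 0" using st by (simp add: cantor_stages_def)
  have M: "real_distribution (M n)" for n
    unfolding M_def by (rule prob_space.real_distribution_distr[OF prob_space_measure_pmf]) simp
  \<comment> \<open>Tightness is formulated with intervals open on the left, and 0 may be an
    endpoint of a cell; hence -1.\<close>
  have unit: "measure (M n) {-1<..1} = 1" for n
  proof -
    have "real j / real N ^ n \<in> {-1<..1}" if "j \<in> J n" for j
    proof -
      have "j < N ^ n" using props(1)[of n] that by auto
      then have "real j < real N ^ n" by (simp flip: of_nat_power)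
      then show ?thesis by (auto simp: divide_le_eq intro: less_le_trans[of _ 0])
    qed
    then show ?thesis
      unfolding M_def using props(3,4)[of n]
      by (subst measure_distr) (auto simp: measure_pmf.prob_eq_1 AE_measure_pmf_iff)
  qed
  have "\<exists>a b. a < b \<and> (\<forall>n. measure (M n) {a<..b} > 1 - \<epsilon>)" if "\<epsilon> > 0" for \<epsilon>
    by (rule exI[of _ "-1"], rule exI[of _ 1]) (use that unit in simp)
  with M have "tight M"
    unfolding tight_def by blast
  then obtain r \<mu> where r: "strict_mono r" and \<mu>: "real_distribution \<mu>" and conv: "weak_conv_m (M \<circ> r) \<mu>"
    using tight_imp_convergent_subsubsequence[of M id] by (auto simp: strict_mono_def)
  interpret \<mu>: real_distribution \<mu> by (rule \<mu>)
  have sub: "C (Suc k) \<subseteq> C k" for k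
  proof
    fix x assume "x \<in> C (Suc k)"
    then obtain i where i: "i \<in> J (Suc k)" "real i \<le> x * real N ^ Suc k" "x * real N ^ Suc k \<le> real i + 1"
      using mem_cell_iff[OF N, of x _ "Suc k"] unfolding C_def by blast
    obtain s where s: "J (Suc k) = children N A (J k) s"
      by (rule cantor_stages_Suc[OF st])
    obtain j a where j: "i = N * j + (a + s j) mod N" "j \<in> J k"
      using i(1) unfolding s children_def by auto
    have "real j \<le> x * real N ^ k \<and> x * real N ^ k \<le> real j + 1"
      using N i unfolding j(1) by (intro parent_cell) auto
    then show "x \<in> C k"
      using mem_cell_iff[OF N, of x j k] j(2) unfolding C_def by blast
  qed
  have "AE x in \<mu>. x \<in> C k" for k
  proof -
    \<comment> \<open>A bounded continuous test function whose zero set is exactly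
      \<open>C k\<close>, as \<open>C k\<close> is closed and nonempty.\<close>
    define f where "f x = min 1 (infdist x (C k))" for x
    have closed: "closed (C k)" and ne: "C k \<noteq> {}"
      using props(3,4)[of k] N by (auto simp: C_def intro!: closed_UN divide_right_mono)
    have cont: "isCont f x" for x
      unfolding f_def by (intro continuous_intros continuous_infdist)
    have f: "f \<in> borel_measurable borel" "0 \<le> f x" "f x \<le> 1" for x
      using cont by (auto simp: f_def infdist_nonneg intro!: borel_measurable_continuous_onI continuous_at_imp_continuous_on)
    have "(\<lambda>n. integral\<^sup>L ((M \<circ> r) n) f) \<longlonglongrightarrow> integral\<^sup>L \<mu> f"
      by (rule weak_conv_imp_integral_bdd_continuous_conv[OF _ \<mu> conv cont, of 1]) (use M f in auto)
    moreover have "integral\<^sup>L ((M \<circ> r) n) f = 0" if "n \<ge> k" for n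
    proof -
      have "f (real j / real N ^ r n) = 0" if "j \<in> J (r n)" for j
      proof -
        have "real j / real N ^ r n \<in> C (r n)"
          unfolding C_def using that N by (auto intro!: divide_right_mono bexI[of _ j])
        moreover have "C (r n) \<subseteq> C k"
          using lift_Suc_antimono_le[of C, OF sub] seq_suble[OF r, of n] \<open>n \<ge> k\<close> by (meson order_trans)
        ultimately show ?thesis by (auto simp: f_def)
      qed
      then show ?thesis
        unfolding M_def comp_def using props(3,4)[of "r n"] f by (subst integral_distr_pmf_of_set) auto
    qed
    then have "(\<lambda>n. integral\<^sup>L ((M \<circ> r) n) f) \<longlonglongrightarrow> 0"
      by (intro tendsto_eventually eventually_sequentiallyI[of k])
    ultimately have "integral\<^sup>L \<mu> f = 0" by (rule LIMSEQ_unique)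
    moreover have "integrable \<mu> f"
      using f by (intro \<mu>.integrable_const_bound[of _ 1]) auto
    ultimately have "AE x in \<mu>. f x = 0"
      using f by (subst (asm) integral_nonneg_eq_0_iff_AE) auto
    then show ?thesis
    proof eventually_elim
      case (elim x)
      then have "infdist x (C k) = 0" by (auto simp: f_def min_def split: if_splits)
      then show ?case using in_closed_iff_infdist_zero[OF closed ne] by simp
    qed
  qed
  then have "AE x in \<mu>. \<forall>k. x \<in> C k" by (simp add: AE_all_countable)
  then have "measure \<mu> (cantor_set N J) = 1"
    using cantor_set_borel(1)[OF st] by (subst \<mu>.prob_eq_1) (auto simp: cantor_set_def C_def)
  moreover have "(\<lambda>n. expsum (J (r n)) (\<xi> / real N ^ r n) / of_nat (card A ^ r n)) \<longlonglongrightarrow> fourier_transform \<mu> \<xi>" for \<xi>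
  proof -
    have "(\<lambda>n. char ((M \<circ> r) n) (- \<xi>)) \<longlonglongrightarrow> char \<mu> (- \<xi>)"
      by (rule levy_continuity1[OF _ \<mu> conv]) (use M in auto)
    moreover have "char (M n) (- \<xi>) = expsum (J n) (\<xi> / real N ^ n) / of_nat (card A ^ n)" for n
      unfolding char_def M_def using props(2,3,4)[of n]
      by (subst integral_distr_pmf_of_set)
        (auto simp: expsum_def cis_conv_exp scaleR_conv_of_real divide_inverse mult_ac)
    ultimately show ?thesis by (simp add: fourier_transform_eq_char)
  qed
  ultimately show ?thesis using r \<mu> by blast
qed

section \<open>Fourier dimension of the limit set and conclusion\<close>

lemma le_fourier_dimension:
  assumes \<mu>: "real_distribution \<mu>" "measure \<mu> E = 1" and \<alpha>: "0 < \<alpha>" "\<alpha> \<le> 1" and B: "B > 0"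
    and decay: "\<And>\<xi>. \<xi> \<noteq> 0 \<Longrightarrow> cmod (fourier_transform \<mu> \<xi>) \<le> B * \<bar>\<xi>\<bar> powr (- \<alpha> / 2)"
  shows "ereal \<alpha> \<le> fourier_dimension E"
proof -
  interpret real_distribution \<mu> by (rule \<mu>)
  define C where "C = (1 + B) * 2 powr (\<alpha> / 2)"
  have "cmod (fourier_transform \<mu> \<xi>) \<le> C * (1 + \<bar>\<xi>\<bar>) powr (- \<alpha> / 2)" for \<xi>
  proof -
    \<comment> \<open>Here \<open>u\<close> is the maximum of 1 and
      \<open>\<bar>\<xi>\<bar>\<close>: small frequencies use the trivial bound 1, the others the
      assumed decay.\<close>
    have "\<exists>u. 0 < u \<and> 1 + \<bar>\<xi>\<bar> \<le> 2 * u \<and> cmod (fourier_transform \<mu> \<xi>) \<le> (1 + B) * u powr (- \<alpha> / 2)"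
    proof (cases "\<bar>\<xi>\<bar> \<le> 1")
      case True
      then show ?thesis
        using cmod_char_le_1[of "- \<xi>"] B by (intro exI[of _ 1]) (simp add: fourier_transform_eq_char)
    next
      case False
      then have "cmod (fourier_transform \<mu> \<xi>) \<le> B * \<bar>\<xi>\<bar> powr (- \<alpha> / 2)"
        by (intro decay) auto
      also have "\<dots> \<le> (1 + B) * \<bar>\<xi>\<bar> powr (- \<alpha> / 2)" by (intro mult_right_mono) auto
      finally show ?thesis using False by (intro exI[of _ "\<bar>\<xi>\<bar>"]) auto
    qed
    then obtain u where u: "0 < u" "1 + \<bar>\<xi>\<bar> \<le> 2 * u"
      "cmod (fourier_transform \<mu> \<xi>) \<le> (1 + B) * u powr (- \<alpha> / 2)" by blast
    note u(3)
    also have "u powr (- \<alpha> / 2) \<le> ((1 + \<bar>\<xi>\<bar>) / 2) powr (- \<alpha> / 2)"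
      using u \<alpha> by (intro powr_mono2') auto
    also have "\<dots> = 2 powr (\<alpha> / 2) * (1 + \<bar>\<xi>\<bar>) powr (- \<alpha> / 2)"
      by (simp add: powr_divide powr_minus_divide)
    finally show ?thesis
      using B by (simp add: C_def mult_left_mono mult.assoc)
  qed
  moreover have "C > 0" using B by (simp add: C_def)
  ultimately show ?thesis
    unfolding fourier_dimension_def using \<mu> \<alpha> by (intro Sup_upper) blast
qed

theorem theorem1p7:
  fixes p :: nat and \<alpha> :: real
  assumes "p \<ge> 2" and "0 < \<alpha>" and "\<alpha> < 1"
  shows "\<exists>(\<kappa>::real) (E::real set).
    \<kappa> > 0 \<and> E \<in> sets borel \<and> E \<subseteq> {0..1} \<and> fourier_dimension E \<ge> ereal \<alpha> \<and>
    (\<forall>t \<in> (\<Union>q\<in>{1..p - 1}. {real q / real p - \<kappa> <..< real q / real p + \<kappa>}).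
      \<not> (\<exists>x\<in>E. \<exists>y\<in>E. \<exists>z\<in>E. x \<noteq> y \<and> y \<noteq> z \<and> x \<noteq> z \<and> t * x + (1 - t) * y = z))"
proof -
  obtain N A where N: "N > 0" and av: "avoiding p N A" and large: "real N powr \<alpha> < real (card A)"
    using ex_large_avoiding[OF assms] by blast
  have A: "A \<subseteq> {..<N}" using av by (simp add: avoiding_def)
  have "A \<noteq> {}" using large by auto
  have "card A \<le> N" using card_mono[OF _ A] by simp
  \<comment> \<open>For \<open>N = 1\<close> the bound \<open>large\<close> would require more than
    one element in \<open>A\<close>.\<close>
  then have N2: "N \<ge> 2" using N large by (cases "N = 1") auto
  obtain J where st: "cantor_stages N A J" and dev: "\<And>k \<theta>.
      cmod (expsum (J (Suc k)) \<theta> / of_nat (card A) - expsum (J k) (real N * \<theta>) * (expsum {..<N} \<theta> / of_nat N))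
    \<le> dev_const N * (real k + 1) * sqrt (card A ^ k)"
    using ex_random_cantor_stages[OF N A \<open>A \<noteq> {}\<close>] by blast
  obtain B where B: "B > 0" "\<And>\<xi> k. \<xi> \<noteq> 0 \<Longrightarrow> \<bar>\<xi>\<bar> \<le> real N ^ k \<Longrightarrow>
      cmod (expsum (J k) (\<xi> / real N ^ k) / of_nat (card A ^ k)) \<le> B * \<bar>\<xi>\<bar> powr (- \<alpha> / 2)"
    using expsum_decay[OF st dev assms(2,3) large] by metis
  obtain \<mu> r where \<mu>: "real_distribution \<mu>" "measure \<mu> (cantor_set N J) = 1" and r: "strict_mono r"
    and lim: "\<And>\<xi>. (\<lambda>n. expsum (J (r n)) (\<xi> / real N ^ r n) / of_nat (card A ^ r n)) \<longlonglongrightarrow> fourier_transform \<mu> \<xi>"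
    using ex_cantor_measure[OF st] by blast
  have "cmod (fourier_transform \<mu> \<xi>) \<le> B * \<bar>\<xi>\<bar> powr (- \<alpha> / 2)" if "\<xi> \<noteq> 0" for \<xi>
  proof -
    \<comment> \<open>The stages decay only at frequencies up to \<open>N ^ k\<close>, so for fixed
      \<xi> the bound holds from some stage on, which suffices in the limit.\<close>
    obtain k where k: "\<bar>\<xi>\<bar> < real N ^ k"
      using real_arch_pow[of "real N" "\<bar>\<xi>\<bar>"] N2 by auto
    have "\<forall>n\<ge>k. cmod (expsum (J (r n)) (\<xi> / real N ^ r n) / of_nat (card A ^ r n)) \<le> B * \<bar>\<xi>\<bar> powr (- \<alpha> / 2)"
    proof (intro allI impI B(2)[OF that])
      fix n assume "k \<le> n"
      then have "real N ^ k \<le> real N ^ r n"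
        using seq_suble[OF r, of n] N by (intro power_increasing) auto
      with k show "\<bar>\<xi>\<bar> \<le> real N ^ r n" by linarith
    qed
    then show ?thesis by (rule Lim_bounded[OF tendsto_norm[OF lim]])
  qed
  then have dim: "ereal \<alpha> \<le> fourier_dimension (cantor_set N J)"
    using le_fourier_dimension[OF \<mu>] assms B(1) by simp
  have avoid: "x = y"
    if "q \<in> {1..p - 1}" "t \<in> {real q / real p - 1 / (real p * real N) <..< real q / real p + 1 / (real p * real N)}"
      "x \<in> cantor_set N J" "y \<in> cantor_set N J" "z \<in> cantor_set N J" "t * x + (1 - t) * y = z"
    for q t x y z
  proof (rule cantor_set_avoids[OF st N2 av assms(1) that(3-5) _ _ _ that(6)])
    show "0 < q" "q < p" using that(1) by auto
    show "\<bar>t - real q / real p\<bar> < 1 / (real p * real N)"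
      using that(2) by (auto simp: abs_less_iff)
  qed
  show ?thesis
  proof (intro exI conjI)
    show "0 < 1 / (real p * real N)" using assms(1) N by simp
    show "\<forall>t\<in>\<Union>q\<in>{1..p - 1}. {real q / real p - 1 / (real p * real N) <..< real q / real p + 1 / (real p * real N)}.
      \<not> (\<exists>x\<in>cantor_set N J. \<exists>y\<in>cantor_set N J. \<exists>z\<in>cantor_set N J.
        x \<noteq> y \<and> y \<noteq> z \<and> x \<noteq> z \<and> t * x + (1 - t) * y = z)"
      using avoid by blast
  qed (use cantor_set_borel[OF st] dim in auto)
qed

end
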